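(* Let $(X,\ll,\leq,\mathfrak T)$ be a topological causal space and let $H\subset X$ be a null non-branching, weakly convex, closed achronal set admitting a gauge function $G$. Let $\mu_0,\mu_1$ be Borel probability measures on $H^\circ$ such that $\Pi_\le(\mu_0,\mu_1)\ne\emptyset$. Then there exists a unique monotone coupling $\pi\in\Pi_\le(\mu_0,\mu_1)$.
   Context: A causal space $(X,\ll,\le)$ is a set $X$ with a preorder $\le$ and a transitive relation $\ll$ contained in $\le$. A topological causal space $(X,\ll,\leq,\mathfrak T)$ is a causal space with a Polish topology $\mathfrak T$ induced by a separable proper metric (closed balls are compact), such that $J:=\{(x,y):x\le y\}$ is closed and $\{(x,y):x\ll y\}$ is open in $X\times X$. A set $H$ is achronal if no $x,y\in H$ satisfy $x\ll y$. A causal curve is a continuous $\gamma:I\to X$ ($I$ an interval) with $\gamma_s\le\gamma_t$ for all $s\le t$ (constant curves allowed). $H$ is weakly convex if any $x,y\in H$ with $x\le y$ are joined by a causal curve contained in $H$. For a closed achronal set $H$: $\mathfrak a=\{m\in H:\nexists x\in H,\ x\le m,\ x\ne m\}$; $\mathfrak b=\{m\in H:\nexists x\in H,\ m\le x,\ x\neq m\}$; $H^\circ=H\setminus(\mathfrak a\cup\mathfrak b)$. A gauge for $H$ is a Borel map $G:H^\circ\to\mathbb R$ such that (1) for any injective causal curve $\gamma$ in $H^\circ$, $G\circ\gamma$ is strictly increasing and continuous; (2) for any causal $\gamma:[0,1]\to H$ with $\gamma((0,1))\subset H^\circ$, $\sup_{(0,1)}G\circ\gamma$ and $\inf_{(0,1)}G\circ\gamma$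 are finite. $H$ is forward null non-branching if for every pair of injective causal curves $\gamma^1,\gamma^2:[0,1]\to H$ with $\gamma^1_0=\gamma^2_0$ and $\gamma^1_{1/2}=\gamma^2_{1/2}$, either $\gamma^1([0,1])\subset\gamma^2([0,1])$ or $\gamma^2([0,1])\subset\gamma^1([0,1])$; backward null non-branching if it is forward null non-branching for the reversed causal relations; null non-branching if both. $\Pi_\le(\mu_0,\mu_1)$ is the set of couplings $\pi$ of $\mu_0,\mu_1$ with $\pi(J)=1$. A set $A\subset X\times X$ is monotone if for all $(x_1,y_1),(x_2,y_2)\in A$: $x_1\le x_2$, $x_1\ne x_2$ implies $y_1\le y_2$. A coupling $\pi\in\Pi_\le(\mu_0,\mu_1)$ is monotone if it is concentrated on a monotone Borel set. *)

theory Defs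
  imports "HOL-Probability.Probability"
begin

locale causal_space =
  fixes ll :: "'a \<Rightarrow> 'a \<Rightarrow> bool" and le :: "'a \<Rightarrow> 'a \<Rightarrow> bool"
  assumes le_refl: "le x x"
    and le_trans: "le x y \<Longrightarrow> le y z \<Longrightarrow> le x z"
    and ll_trans: "ll x y \<Longrightarrow> ll y z \<Longrightarrow> ll x z"
    and ll_imp_le: "ll x y \<Longrightarrow> le x y"

definition causal_rel :: "('a \<Rightarrow> 'a \<Rightarrow> bool) \<Rightarrow> ('a \<times> 'a) set" where
  "causal_rel le = {(x, y). le x y}"

text \<open>The space is the whole type; the metric of the type class is the separable proper
  metric inducing the Polish topology.\<close>

locale topological_causal_space = causal_space ll le
  for ll :: "'a::polish_space \<Rightarrow> 'a \<Rightarrow> bool" and le :: "'a \<Rightarrow> 'a \<Rightarrow> bool" +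
  assumes proper: "compact (cball (x::'a) r)"
    and closed_le: "closed (causal_rel le)"
    and open_ll: "open {(x, y). ll x y}"

definition achronal :: "('a \<Rightarrow> 'a \<Rightarrow> bool) \<Rightarrow> 'a set \<Rightarrow> bool" where
  "achronal ll H \<longleftrightarrow> \<not> (\<exists>x\<in>H. \<exists>y\<in>H. ll x y)"

definition causal_curve ::
    "('a::topological_space \<Rightarrow> 'a \<Rightarrow> bool) \<Rightarrow> real set \<Rightarrow> (real \<Rightarrow> 'a) \<Rightarrow> bool" where
  "causal_curve le I \<gamma> \<longleftrightarrow>
     is_interval I \<and> continuous_on I \<gamma> \<and> (\<forall>s\<in>I. \<forall>t\<in>I. s \<le> t \<longrightarrow> le (\<gamma> s) (\<gamma> t))"

definition weakly_convex :: "('a::topological_space \<Rightarrow> 'a \<Rightarrow> bool) \<Rightarrow> 'a set \<Rightarrow> bool" where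
  "weakly_convex le H \<longleftrightarrow>
     (\<forall>x\<in>H. \<forall>y\<in>H. le x y \<longrightarrow>
        (\<exists>a b \<gamma>. a \<le> b \<and> causal_curve le {a..b} \<gamma> \<and> \<gamma> a = x \<and> \<gamma> b = y \<and> \<gamma> ` {a..b} \<subseteq> H))"

definition initial_points :: "('a \<Rightarrow> 'a \<Rightarrow> bool) \<Rightarrow> 'a set \<Rightarrow> 'a set" where
  "initial_points le H = {m \<in> H. \<not> (\<exists>x\<in>H. le x m \<and> x \<noteq> m)}"

definition final_points :: "('a \<Rightarrow> 'a \<Rightarrow> bool) \<Rightarrow> 'a set \<Rightarrow> 'a set" where
  "final_points le H = {m \<in> H. \<not> (\<exists>x\<in>H. le m x \<and> x \<noteq> m)}"

definition inner_part :: "('a \<Rightarrow> 'a \<Rightarrow> bool) \<Rightarrow> 'a set \<Rightarrow> 'a set" where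
  "inner_part le H = H - (initial_points le H \<union> final_points le H)"

text \<open>Only the values of \<open>G\<close> on the inner part of \<open>H\<close> matter.\<close>

definition gauge_for ::
    "('a::topological_space \<Rightarrow> 'a \<Rightarrow> bool) \<Rightarrow> 'a set \<Rightarrow> ('a \<Rightarrow> real) \<Rightarrow> bool" where
  "gauge_for le H G \<longleftrightarrow>
     G \<in> borel_measurable (restrict_space borel (inner_part le H)) \<and>
     (\<forall>I \<gamma>. causal_curve le I \<gamma> \<and> inj_on \<gamma> I \<and> \<gamma> ` I \<subseteq> inner_part le H \<longrightarrow>
        strict_mono_on I (G \<circ> \<gamma>) \<and> continuous_on I (G \<circ> \<gamma>)) \<and>
     (\<forall>\<gamma>. causal_curve le {0..1} \<gamma> \<and> \<gamma> ` {0..1} \<subseteq> H \<and> \<gamma> ` {0<..<1} \<subseteq> inner_part le H \<longrightarrow>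
        bdd_above ((G \<circ> \<gamma>) ` {0<..<1}) \<and> bdd_below ((G \<circ> \<gamma>) ` {0<..<1}))"

definition forward_null_nonbranching ::
    "('a::topological_space \<Rightarrow> 'a \<Rightarrow> bool) \<Rightarrow> 'a set \<Rightarrow> bool" where
  "forward_null_nonbranching le H \<longleftrightarrow>
     (\<forall>\<gamma>1 \<gamma>2.
        causal_curve le {0..1} \<gamma>1 \<and> inj_on \<gamma>1 {0..1} \<and> \<gamma>1 ` {0..1} \<subseteq> H \<and>
        causal_curve le {0..1} \<gamma>2 \<and> inj_on \<gamma>2 {0..1} \<and> \<gamma>2 ` {0..1} \<subseteq> H \<and>
        \<gamma>1 0 = \<gamma>2 0 \<and> \<gamma>1 (1/2) = \<gamma>2 (1/2) \<longrightarrow>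
        \<gamma>1 ` {0..1} \<subseteq> \<gamma>2 ` {0..1} \<or> \<gamma>2 ` {0..1} \<subseteq> \<gamma>1 ` {0..1})"

definition backward_null_nonbranching ::
    "('a::topological_space \<Rightarrow> 'a \<Rightarrow> bool) \<Rightarrow> 'a set \<Rightarrow> bool" where
  "backward_null_nonbranching le H \<longleftrightarrow> forward_null_nonbranching (\<lambda>x y. le y x) H"

definition null_nonbranching :: "('a::topological_space \<Rightarrow> 'a \<Rightarrow> bool) \<Rightarrow> 'a set \<Rightarrow> bool" where
  "null_nonbranching le H \<longleftrightarrow>
     forward_null_nonbranching le H \<and> backward_null_nonbranching le H"

text \<open>A Borel probability measure on a subset is represented by its extension by zero to the
  whole type.\<close>

definition borel_prob_on :: "'a::topological_space set \<Rightarrow> 'a measure \<Rightarrow> bool" where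
  "borel_prob_on S \<mu> \<longleftrightarrow> prob_space \<mu> \<and> sets \<mu> = sets borel \<and> (AE x in \<mu>. x \<in> S)"

definition couplings ::
    "'a::topological_space measure \<Rightarrow> 'a measure \<Rightarrow> ('a \<times> 'a) measure set" where
  "couplings \<mu>0 \<mu>1 =
     {\<pi>. prob_space \<pi> \<and> sets \<pi> = sets borel \<and> distr \<pi> borel fst = \<mu>0 \<and> distr \<pi> borel snd = \<mu>1}"

definition causal_couplings ::
    "('a::topological_space \<Rightarrow> 'a \<Rightarrow> bool) \<Rightarrow> 'a measure \<Rightarrow> 'a measure \<Rightarrow> ('a \<times> 'a) measure set" where
  "causal_couplings le \<mu>0 \<mu>1 = {\<pi> \<in> couplings \<mu>0 \<mu>1. emeasure \<pi> (causal_rel le) = 1}"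

definition monotone_set :: "('a \<Rightarrow> 'a \<Rightarrow> bool) \<Rightarrow> ('a \<times> 'a) set \<Rightarrow> bool" where
  "monotone_set le A \<longleftrightarrow>
     (\<forall>(x1, y1)\<in>A. \<forall>(x2, y2)\<in>A. le x1 x2 \<and> x1 \<noteq> x2 \<longrightarrow> le y1 y2)"

definition concentrated_on_monotone ::
    "('a::topological_space \<Rightarrow> 'a \<Rightarrow> bool) \<Rightarrow> ('a \<times> 'a) measure \<Rightarrow> bool" where
  "concentrated_on_monotone le \<pi> \<longleftrightarrow>
     (\<exists>A\<in>sets borel. monotone_set le A \<and> emeasure \<pi> A = 1)"

end

theory Submission
  imports Defs
begin

text \<open>
  The gauge excludes causal loops, so \<open>\<le>\<close> is antisymmetric on \<open>H\<close>, and null non-branching makes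
  comparability an equivalence relation on the inner part \<open>H\<^sup>o\<close>. On each class (leaf) the order is
  total and the gauge is strictly increasing. Since \<open>J\<close> is closed and the space is
  \<open>\<sigma>\<close>-compact, there is a Borel map \<open>\<Phi>\<close> whose fibres in \<open>H\<^sup>o\<close> are exactly the leaves. The pair
  \<open>(\<Phi>, G)\<close> is therefore an injective Borel map, and by Lusin's theorem it has a Borel inverse up
  to null sets. The problem becomes the one-dimensional monotone rearrangement in every fibre
  of \<open>\<Phi>\<close>: both measures have the same image \<open>\<lambda>\<close> under \<open>\<Phi>\<close>, and existence follows by applying the
  two conditional quantile functions to \<open>\<lambda>\<close> times the uniform distribution. For uniqueness, a
  monotone coupling \<open>\<pi>\<close> satisfies
  \<open>\<pi> {\<Phi> \<in> B, G x < s, G y < t} = min\<^sub>Z \<mu>1 {\<Phi> \<in> B \<inter> Z, G < t} + \<mu>0 {\<Phi> \<in> B - Z, G < s}\<close>,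
  the minimum being over Borel sets \<open>Z\<close>; the right-hand side does not depend on \<open>\<pi>\<close>.
\<close>

section \<open>Arcs in metric spaces and causal arcs\<close>

text \<open>The Kuratowski embedding into the Banach space of bounded continuous functions;
  subtracting the distance to the base point \<open>o'\<close> makes the functions bounded. It moves
  paths into a normed space, the setting of \<open>path_contains_arc\<close>.\<close>

definition kuratowski :: "'a::metric_space \<Rightarrow> 'a \<Rightarrow> ('a \<Rightarrow>\<^sub>C real)" where
  "kuratowski o' x = Bcontfun (\<lambda>z. dist x z - dist o' z)"

lemma apply_kuratowski: "apply_bcontfun (kuratowski o' x) z = dist x z - dist o' z"
proof -
  have "(\<lambda>z. dist x z - dist o' z) \<in> bcontfun"
  proof (rule bcontfun_normI)
    show "continuous_on UNIV (\<lambda>z. dist x z - dist o' z)"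
      by (intro continuous_intros)
    show "norm (dist x z - dist o' z) \<le> dist x o'" for z
      using abs_dist_diff_le[of x z o'] by (simp add: dist_commute)
  qed
  then show ?thesis
    unfolding kuratowski_def by (simp add: Bcontfun_inverse)
qed

lemma dist_kuratowski_le: "dist (kuratowski o' x) (kuratowski o' y) \<le> dist x y"
proof (rule dist_bound)
  fix z
  show "dist (apply_bcontfun (kuratowski o' x) z) (apply_bcontfun (kuratowski o' y) z) \<le> dist x y"
    using abs_dist_diff_le[of x z y] by (simp add: apply_kuratowski dist_real_def dist_commute)
qed

lemma continuous_on_kuratowski: "continuous_on A (kuratowski o')"
  unfolding continuous_on_iff by (meson dist_kuratowski_le le_less_trans)

lemma inj_kuratowski: "inj (kuratowski o')"
proof (rule injI)
  fix x y :: 'a assume "kuratowski o' x = kuratowski o' y"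
  then have "dist x y - dist o' y = dist y y - dist o' y"
    by (metis apply_kuratowski)
  then show "x = y" by simp
qed

text \<open>An arc is extracted from the embedded path and pulled back. The inverse embedding is
  continuous there because a continuous injection on the compact path image is a homeomorphism onto
  its image.\<close>

lemma metric_path_contains_arc:
  fixes p :: "real \<Rightarrow> 'a::metric_space"
  assumes p: "path p" "pathstart p \<noteq> pathfinish p"
  obtains q where "arc q" "path_image q \<subseteq> path_image p"
    "pathstart q = pathstart p" "pathfinish q = pathfinish p"
proof -
  let ?k = "kuratowski (pathstart p)"
  let ?h = "inv_into UNIV ?k"
  have h: "?h (?k x) = x" for x
    by (simp add: inj_kuratowski)
  have kp: "path (?k \<circ> p)"
    by (intro path_continuous_image p continuous_on_kuratowski)
  obtain q where q: "arc q" "path_image q \<subseteq> path_image (?k \<circ> p)"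
    "pathstart q = ?k (pathstart p)" "pathfinish q = ?k (pathfinish p)"
    using path_contains_arc[OF kp, of "?k (pathstart p)" "?k (pathfinish p)"] p(2)
      inj_kuratowski[of "pathstart p", THEN injD, of "pathstart p" "pathfinish p"]
    by (auto simp: pathstart_compose pathfinish_compose)
  have sub: "path_image q \<subseteq> ?k ` path_image p"
    using q(2) by (simp add: path_image_compose)
  have "continuous_on (?k ` path_image p) ?h"
    by (intro continuous_on_inv continuous_on_kuratowski compact_path_image p) (simp add: h)
  then have "continuous_on (path_image q) ?h"
    using sub continuous_on_subset by blast
  moreover have "inj_on ?h (path_image q)"
    by (metis (no_types, lifting) image_mono inj_on_inv_into inj_on_subset sub top_greatest)
  ultimately have "arc (?h \<circ> q)"
    using q(1) by (auto simp: arc_def path_image_def intro!: path_continuous_image comp_inj_on)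
  moreover have "path_image (?h \<circ> q) \<subseteq> path_image p"
    using sub h by (auto simp: path_image_compose)
  ultimately show ?thesis
    by (intro that[of "?h \<circ> q"]) (simp_all add: q h pathstart_compose pathfinish_compose)
qed

definition causal_arc :: "('a::topological_space \<Rightarrow> 'a \<Rightarrow> bool) \<Rightarrow> (real \<Rightarrow> 'a) \<Rightarrow> bool" where
  "causal_arc le q \<longleftrightarrow> causal_curve le {0..1} q \<and> inj_on q {0..1}"

lemma causal_arcI:
  assumes "arc q" "\<And>s t. 0 \<le> s \<Longrightarrow> s \<le> t \<Longrightarrow> t \<le> 1 \<Longrightarrow> le (q s) (q t)"
  shows "causal_arc le q"
  using assms by (auto simp: causal_arc_def causal_curve_def arc_def path_def)

lemma causal_arc_imp_arc: "causal_arc le q \<Longrightarrow> arc q"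
  by (auto simp: causal_arc_def causal_curve_def arc_def path_def)

lemma causal_arc_mono: "causal_arc le q \<Longrightarrow> 0 \<le> s \<Longrightarrow> s \<le> t \<Longrightarrow> t \<le> 1 \<Longrightarrow> le (q s) (q t)"
  by (auto simp: causal_arc_def causal_curve_def)

text \<open>The triangle of pairs \<open>s < t\<close> is connected and is covered by the two disjoint relatively
  closed sets where \<open>q s \<le> q t\<close> and where \<open>q t \<le> q s\<close>.\<close>

lemma arc_in_chain_is_causal:
  fixes q :: "real \<Rightarrow> 'a::t2_space"
  assumes closed: "closed (causal_rel le)" and q: "arc q"
    and chain: "\<And>z w. z \<in> path_image q \<Longrightarrow> w \<in> path_image q \<Longrightarrow> le z w \<or> le w z"
    and antisym: "\<And>z w. z \<in> path_image q \<Longrightarrow> w \<in> path_image q \<Longrightarrow> le z w \<Longrightarrow> le w z \<Longrightarrow> z = w"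
    and ends: "le (pathstart q) (pathfinish q)"
  shows "causal_arc le q"
proof (rule causal_arcI[OF q])
  define T where "T = {(s::real, t). 0 \<le> s \<and> s < t \<and> t \<le> 1}"
  have img: "q s \<in> path_image q" if "0 \<le> s" "s \<le> 1" for s
    using that by (auto simp: path_image_def)
  have inj: "inj_on q {0..1}" and cq: "continuous_on {0..1} q"
    using q by (auto simp: arc_def path_def)
  have "convex T"
  proof -
    have "T = {p. (1, 0) \<bullet> p \<ge> 0} \<inter> {p. (1, -1) \<bullet> p < 0} \<inter> {p. (0, 1) \<bullet> p \<le> 1}"
      by (auto simp: T_def)
    then show ?thesis
      by (simp only:) (intro convex_Int convex_halfspace_ge convex_halfspace_le convex_halfspace_lt)
  qed
  then have conn: "connected T" by (rule convex_connected)
  have c1: "continuous_on T (\<lambda>p. (q (fst p), q (snd p)))"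
    by (intro continuous_on_Pair continuous_on_compose2[OF cq] continuous_intros)
       (auto simp: T_def)
  have c2: "continuous_on T (\<lambda>p. (q (snd p), q (fst p)))"
    by (intro continuous_on_Pair continuous_on_compose2[OF cq] continuous_intros)
       (auto simp: T_def)
  define A where "A = {p \<in> T. le (q (fst p)) (q (snd p))}"
  define B where "B = {p \<in> T. le (q (snd p)) (q (fst p))}"
  have A: "closedin (top_of_set T) A"
    using continuous_closedin_preimage[OF c1 closed]
    by (simp add: A_def causal_rel_def vimage_def Int_def conj_commute)
  have B: "closedin (top_of_set T) B"
    using continuous_closedin_preimage[OF c2 closed]
    by (simp add: B_def causal_rel_def vimage_def Int_def conj_commute)
  have "A \<inter> B = {}"
  proof -
    have False if "p \<in> A" "p \<in> B" for p
    proof -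
      have "q (fst p) = q (snd p)"
        using that antisym[of "q (fst p)" "q (snd p)"] img by (auto simp: A_def B_def T_def)
      then show False
        using that inj_onD[OF inj, of "fst p" "snd p"] by (auto simp: A_def T_def)
    qed
    then show ?thesis by blast
  qed
  moreover have "T \<subseteq> A \<union> B"
  proof
    fix p assume p: "p \<in> T"
    then show "p \<in> A \<union> B"
      using chain[OF img img, of "fst p" "snd p"] by (auto simp: A_def B_def T_def)
  qed
  moreover have "(0, 1) \<in> A"
    using ends by (auto simp: A_def T_def pathstart_def pathfinish_def)
  ultimately have "B = {}"
    using conn A B unfolding connected_closedin
    by (metis closedin_imp_subset closedin_subset empty_iff topspace_euclidean_subtopology
        A_def B_def)
  then have "T \<subseteq> A"
    using \<open>T \<subseteq> A \<union> B\<close> by blast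
  fix s t :: real assume st: "0 \<le> s" "s \<le> t" "t \<le> 1"
  show "le (q s) (q t)"
  proof (cases "s = t")
    case True
    then show ?thesis using chain img[of s] st by auto
  next
    case False
    then have "(s, t) \<in> T" using st by (auto simp: T_def)
    then show ?thesis using \<open>T \<subseteq> A\<close> by (auto simp: A_def)
  qed
qed

section \<open>Leaves of a gauged null set\<close>

lemma causal_arc_reverse:
  "causal_arc le q \<Longrightarrow> causal_arc (\<lambda>x y. le y x) (reversepath q)"
  by (rule causal_arcI, simp add: arc_reversepath causal_arc_imp_arc)
     (auto simp: reversepath_def intro: causal_arc_mono)

text \<open>A point common to both arcs lies before and after the junction, so by antisymmetry it is
  the junction; this gives injectivity. Transitivity and antisymmetry are hypotheses so that the
  lemma also applies to the reversed relation.\<close>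

lemma causal_arc_join:
  assumes trans: "\<And>x y z. le x y \<Longrightarrow> le y z \<Longrightarrow> le x z"
    and antisym: "\<And>x y. x \<in> H \<Longrightarrow> y \<in> H \<Longrightarrow> le x y \<Longrightarrow> le y x \<Longrightarrow> x = y"
    and p: "causal_arc le p" "path_image p \<subseteq> H"
    and q: "causal_arc le q" "path_image q \<subseteq> H"
    and "pathfinish p = pathstart q"
  shows "causal_arc le (p +++ q)"
proof (rule causal_arcI)
  have pq: "p 1 = q 0"
    using assms(7) by (simp add: pathstart_def pathfinish_def)
  have p1: "le (p s) (q 0)" if "0 \<le> s" "s \<le> 1" for s
    using causal_arc_mono[OF p(1), of s 1] that pq by simp
  have q0: "le (q 0) (q s)" if "0 \<le> s" "s \<le> 1" for s
    using causal_arc_mono[OF q(1), of 0 s] that by simp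
  have "z = q 0" if z: "z \<in> path_image p" "z \<in> path_image q" for z
  proof (rule antisym)
    show "z \<in> H" "q 0 \<in> H"
      using z p(2) q(2) by (auto simp: path_image_def)
    show "le z (q 0)" "le (q 0) z"
      using z p1 q0 unfolding path_image_def by force+
  qed
  then show "arc (p +++ q)"
    by (intro arc_join causal_arc_imp_arc[OF p(1)] causal_arc_imp_arc[OF q(1)] assms(7))
       (auto simp: pathstart_def)
  fix s t :: real assume "0 \<le> s" "s \<le> t" "t \<le> 1"
  then show "le ((p +++ q) s) ((p +++ q) t)"
    using causal_arc_mono[OF p(1), of "2 * s" "2 * t"]
      causal_arc_mono[OF q(1), of "2 * s - 1" "2 * t - 1"]
      trans[OF p1[of "2 * s"] q0[of "2 * t - 1"]]
    by (auto simp: joinpaths_def)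
qed

text \<open>Both arcs leaving \<open>x\<close> are prolonged backwards by the same arc from
  \<open>w\<close> to \<open>x\<close>. The two concatenations agree at times \<open>0\<close> and
  \<open>1/2\<close>, so non-branching nests their images, and the end of the inner one is a point
  of the outer one, hence before its end.\<close>

lemma nonbranching_comparable:
  assumes trans: "\<And>x y z. le x y \<Longrightarrow> le y z \<Longrightarrow> le x z"
    and antisym: "\<And>x y. x \<in> H \<Longrightarrow> y \<in> H \<Longrightarrow> le x y \<Longrightarrow> le y x \<Longrightarrow> x = y"
    and arcs: "\<And>x y. x \<in> H \<Longrightarrow> y \<in> H \<Longrightarrow> le x y \<Longrightarrow> x \<noteq> y \<Longrightarrow>
       \<exists>q. causal_arc le q \<and> pathstart q = x \<and> pathfinish q = y \<and> path_image q \<subseteq> H"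
    and nb: "forward_null_nonbranching le H"
    and H: "w \<in> H" "x \<in> H" "y \<in> H" "z \<in> H"
    and "le w x" "w \<noteq> x" "le x y" "le x z"
  shows "le y z \<or> le z y"
proof (cases "x = y \<or> x = z")
  case True
  then show ?thesis using assms by auto
next
  case False
  obtain p where p: "causal_arc le p" "pathstart p = w" "pathfinish p = x" "path_image p \<subseteq> H"
    using arcs[of w x] assms(5-) by blast
  obtain q where q: "causal_arc le q" "pathstart q = x" "pathfinish q = y" "path_image q \<subseteq> H"
    using arcs[of x y] assms(5-) False by blast
  obtain r where r: "causal_arc le r" "pathstart r = x" "pathfinish r = z" "path_image r \<subseteq> H"
    using arcs[of x z] assms(5-) False by blast
  let ?a = "p +++ q" and ?b = "p +++ r"
  have a: "causal_arc le ?a"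
    by (rule causal_arc_join[OF trans antisym p(1,4) q(1,4)]) (auto simp: p q)
  have b: "causal_arc le ?b"
    by (rule causal_arc_join[OF trans antisym p(1,4) r(1,4)]) (auto simp: p r)
  have H': "?a ` {0..1} \<subseteq> H" "?b ` {0..1} \<subseteq> H"
    using path_image_join_subset[of p q] path_image_join_subset[of p r] p q r
    unfolding path_image_def by blast+
  have ends: "?a 1 = y" "?b 1 = z" "?a 0 = ?b 0" "?a (1/2) = ?b (1/2)"
    using q r by (auto simp: joinpaths_def pathfinish_def)
  have "?a ` {0..1} \<subseteq> ?b ` {0..1} \<or> ?b ` {0..1} \<subseteq> ?a ` {0..1}"
    using nb a b H' ends(3,4) unfolding forward_null_nonbranching_def causal_arc_def by blast
  then show ?thesis
  proof
    assume "?a ` {0..1} \<subseteq> ?b ` {0..1}"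
    then have "?a 1 \<in> ?b ` {0..1}" by (rule subsetD) auto
    then obtain t where "0 \<le> t" "t \<le> 1" "y = ?b t"
      unfolding ends by auto
    then show ?thesis using causal_arc_mono[OF b, of t 1] ends by auto
  next
    assume "?b ` {0..1} \<subseteq> ?a ` {0..1}"
    then have "?b 1 \<in> ?a ` {0..1}" by (rule subsetD) auto
    then obtain t where "0 \<le> t" "t \<le> 1" "z = ?a t"
      unfolding ends by auto
    then show ?thesis using causal_arc_mono[OF a, of t 1] ends by auto
  qed
qed

section \<open>The causal order on a null set with a gauge\<close>

locale gauged_null_set = topological_causal_space ll le
  for ll le :: "'a::polish_space \<Rightarrow> 'a \<Rightarrow> bool" +
  fixes H :: "'a set" and G :: "'a \<Rightarrow> real"
  assumes closed_H: "closed H"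
    and nonbranching: "null_nonbranching le H"
    and weakly_convex: "weakly_convex le H"
    and gauge: "gauge_for le H G"
begin

abbreviation "core \<equiv> inner_part le H"

lemma core_subset: "core \<subseteq> H"
  by (auto simp: inner_part_def)

lemma coreI:
  assumes "z \<in> H" "x \<in> H" "le x z" "x \<noteq> z" "y \<in> H" "le z y" "y \<noteq> z"
  shows "z \<in> core"
  using assms by (auto simp: inner_part_def initial_points_def final_points_def)

lemma gauge_causal_arc_less:
  assumes "causal_arc le q" "path_image q \<subseteq> core"
  shows "G (pathstart q) < G (pathfinish q)"
proof -
  have "strict_mono_on {0..1} (G \<circ> q)"
    using gauge assms unfolding gauge_for_def causal_arc_def path_image_def by blast
  then have "(G \<circ> q) 0 < (G \<circ> q) 1"
    by (rule strict_mono_onD) auto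
  then show ?thesis by (simp add: pathstart_def pathfinish_def)
qed

text \<open>A connecting causal curve may pause and, before antisymmetry is known, revisit points,
  so an arc is chosen inside its image. The arc need not follow the order of the curve, but its
  points are pairwise comparable because they are values of the curve.\<close>

lemma exists_arc_between:
  assumes "x \<in> H" "y \<in> H" "le x y" "x \<noteq> y"
  obtains q where "arc q" "pathstart q = x" "pathfinish q = y" "path_image q \<subseteq> H"
    "\<And>z. z \<in> path_image q \<Longrightarrow> le x z \<and> le z y"
    "\<And>z w. z \<in> path_image q \<Longrightarrow> w \<in> path_image q \<Longrightarrow> le z w \<or> le w z"
proof -
  obtain a b \<gamma> where ab: "a \<le> b" and \<gamma>: "causal_curve le {a..b} \<gamma>" "\<gamma> a = x" "\<gamma> b = y"
    "\<gamma> ` {a..b} \<subseteq> H"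
    using weakly_convex assms unfolding weakly_convex_def by metis
  define p where "p t = \<gamma> (a + t * (b - a))" for t
  have in_ab: "a + t * (b - a) \<in> {a..b}" if "t \<in> {0..1}" for t
    using that ab mult_left_le_one_le[of "b - a" t] by auto
  have "continuous_on {0..1} p"
    unfolding p_def
  proof (rule continuous_on_compose2[where g = \<gamma> and f = "\<lambda>t. a + t * (b - a)"])
    show "continuous_on {a..b} \<gamma>"
      using \<gamma>(1) by (simp add: causal_curve_def)
    show "continuous_on {0..1} (\<lambda>t. a + t * (b - a))"
      by (intro continuous_intros)
    show "(\<lambda>t. a + t * (b - a)) ` {0..1} \<subseteq> {a..b}"
      using in_ab by blast
  qed
  then have p: "path p" "pathstart p = x" "pathfinish p = y"
    using \<gamma> by (auto simp: path_def p_def pathstart_def pathfinish_def)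
  have sub: "path_image p \<subseteq> \<gamma> ` {a..b}"
    using in_ab by (auto simp: path_image_def p_def)
  obtain q where q: "arc q" "path_image q \<subseteq> path_image p"
    "pathstart q = pathstart p" "pathfinish q = pathfinish p"
    using metric_path_contains_arc[of p] p assms by metis
  have mono: "le (\<gamma> s) (\<gamma> t)" if "s \<in> {a..b}" "t \<in> {a..b}" "s \<le> t" for s t
    using \<gamma>(1) that by (auto simp: causal_curve_def)
  show thesis
  proof (rule that[OF q(1)])
    show "pathstart q = x" "pathfinish q = y" "path_image q \<subseteq> H"
      using q p sub \<gamma>(4) by auto
    fix z assume "z \<in> path_image q"
    then obtain s where s: "s \<in> {a..b}" "z = \<gamma> s" using q sub by blast
    show "le x z \<and> le z y"
      using mono[of a s] mono[of s b] s ab \<gamma> by auto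
    fix w assume "w \<in> path_image q"
    then obtain t where t: "t \<in> {a..b}" "w = \<gamma> t" using q sub by blast
    show "le z w \<or> le w z"
      using mono[of s t] mono[of t s] s t by (cases s t rule: le_cases) auto
  qed
qed

text \<open>On a causal loop both an arc and its reversal would be causal, and the gauge would increase
  along both.\<close>

lemma le_antisym_on_H:
  assumes xy: "x \<in> H" "y \<in> H" "le x y" "le y x"
  shows "x = y"
proof (rule ccontr)
  assume "x \<noteq> y"
  then obtain q where q: "arc q" "pathstart q = x" "pathfinish q = y" "path_image q \<subseteq> H"
    and between: "\<And>z. z \<in> path_image q \<Longrightarrow> le x z \<and> le z y"
    using exists_arc_between[OF xy(1-3)] by metis
  \<comment> \<open>The chain is \<open>z \<le> y \<le> x \<le> w\<close>.\<close>
  have all: "le z w" if "z \<in> path_image q" "w \<in> path_image q" for z w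
    using between that xy(4) le_trans by blast
  have core: "path_image q \<subseteq> core"
  proof
    fix z assume z: "z \<in> path_image q"
    have "x \<in> path_image q" "y \<in> path_image q"
      using q by (metis pathstart_in_path_image pathfinish_in_path_image)+
    \<comment> \<open>Since \<open>x\<close> and \<open>y\<close> differ, one of them differs from
      \<open>z\<close>, and it serves both as predecessor and as successor of
      \<open>z\<close>.\<close>
    then show "z \<in> core"
      using coreI[of z x x] coreI[of z y y] \<open>x \<noteq> y\<close> z all q(4) by blast
  qed
  have img: "q t \<in> path_image q" if "0 \<le> t" "t \<le> 1" for t
    using that by (auto simp: path_image_def)
  have "causal_arc le q"
    by (rule causal_arcI[OF q(1)]) (auto intro!: all img)
  then have "G x < G y"
    using gauge_causal_arc_less core q by metis
  have "causal_arc le (reversepath q)"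
    by (rule causal_arcI, simp add: arc_reversepath q)
       (auto intro!: all img simp: reversepath_def)
  then have "G y < G x"
    using gauge_causal_arc_less[of "reversepath q"] core q by simp
  with \<open>G x < G y\<close> show False by simp
qed

lemma exists_causal_arc:
  assumes "x \<in> H" "y \<in> H" "le x y" "x \<noteq> y"
  obtains q where "causal_arc le q" "pathstart q = x" "pathfinish q = y" "path_image q \<subseteq> H"
    "\<And>z. z \<in> path_image q \<Longrightarrow> le x z \<and> le z y"
proof -
  obtain q where q: "arc q" "pathstart q = x" "pathfinish q = y" "path_image q \<subseteq> H"
    "\<And>z. z \<in> path_image q \<Longrightarrow> le x z \<and> le z y"
    "\<And>z w. z \<in> path_image q \<Longrightarrow> w \<in> path_image q \<Longrightarrow> le z w \<or> le w z"
    using exists_arc_between[OF assms] by metis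
  have "causal_arc le q"
    using q assms(3) le_antisym_on_H by (intro arc_in_chain_is_causal closed_le) blast+
  with q show thesis by (intro that) auto
qed

text \<open>The arc from \<open>x\<close> to \<open>y\<close> stays in the core, because each point
  other than the ends has \<open>x\<close> strictly before it and \<open>y\<close> strictly after
  it. Hence the gauge increases along it.\<close>

lemma gauge_strict_mono:
  assumes xy: "x \<in> core" "y \<in> core" "le x y" "x \<noteq> y"
  shows "G x < G y"
proof -
  have H: "x \<in> H" "y \<in> H" using xy core_subset by auto
  obtain q where q: "causal_arc le q" "pathstart q = x" "pathfinish q = y" "path_image q \<subseteq> H"
    "\<And>z. z \<in> path_image q \<Longrightarrow> le x z \<and> le z y"
    using exists_causal_arc[OF H xy(3,4)] by metis
  have "path_image q \<subseteq> core"
  proof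
    fix z assume z: "z \<in> path_image q"
    then show "z \<in> core"
      using coreI[of z x y] q(4,5) xy H by (cases "z = x"; cases "z = y") auto
  qed
  then show ?thesis using gauge_causal_arc_less q by metis
qed

text \<open>A core point has a strict predecessor \<open>w\<close> in \<open>H\<close>, which
  supplies the common initial arc for the non-branching argument.\<close>

lemma forward_comparable:
  assumes "x \<in> core" "y \<in> H" "z \<in> H" "le x y" "le x z"
  shows "le y z \<or> le z y"
proof -
  obtain w where w: "w \<in> H" "le w x" "w \<noteq> x"
    using assms(1) by (auto simp: inner_part_def initial_points_def)
  show ?thesis
  proof (rule nonbranching_comparable[where le = le and H = H and w = w and x = x])
    show "\<exists>q. causal_arc le q \<and> pathstart q = u \<and> pathfinish q = v \<and> path_image q \<subseteq> H"
      if "u \<in> H" "v \<in> H" "le u v" "u \<noteq> v" for u v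
      using exists_causal_arc[OF that] by metis
    show "forward_null_nonbranching le H"
      using nonbranching by (simp add: null_nonbranching_def)
    show "x \<in> H"
      using assms(1) core_subset by blast
  qed (fact w assms le_trans le_antisym_on_H)+
qed

text \<open>The time reverse: \<open>x\<close> has a strict successor, and reversed causal arcs are
  causal for the reversed relation.\<close>

lemma backward_comparable:
  assumes "x \<in> core" "y \<in> H" "z \<in> H" "le y x" "le z x"
  shows "le y z \<or> le z y"
proof -
  obtain w where w: "w \<in> H" "le x w" "w \<noteq> x"
    using assms(1) by (auto simp: inner_part_def final_points_def)
  have "le z y \<or> le y z"
  proof (rule nonbranching_comparable[where le = "\<lambda>x y. le y x" and H = H and w = w and x = x])
    show "\<exists>q. causal_arc (\<lambda>x y. le y x) q \<and> pathstart q = u \<and> pathfinish q = v \<and> path_image q \<subseteq> H"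
      if uv: "u \<in> H" "v \<in> H" "le v u" "u \<noteq> v" for u v
    proof -
      obtain q where "causal_arc le q" "pathstart q = v" "pathfinish q = u" "path_image q \<subseteq> H"
        using exists_causal_arc[of v u] uv by metis
      then show ?thesis
        by (intro exI[of _ "reversepath q"]) (simp add: causal_arc_reverse)
    qed
    show "forward_null_nonbranching (\<lambda>x y. le y x) H"
      using nonbranching by (simp add: null_nonbranching_def backward_null_nonbranching_def)
    show "x \<in> H"
      using assms(1) core_subset by blast
    show "le c a" if "le b a" "le c b" for a b c
      using that le_trans by blast
    show "a = b" if "a \<in> H" "b \<in> H" "le b a" "le a b" for a b
      using that le_antisym_on_H by blast
  qed (fact w assms)+
  then show ?thesis by blast
qed

definition comparable :: "'a \<Rightarrow> 'a \<Rightarrow> bool" where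
  "comparable x y \<longleftrightarrow> le x y \<or> le y x"

lemma comparable_refl: "comparable x x"
  by (simp add: comparable_def le_refl)

lemma comparable_sym: "comparable x y \<Longrightarrow> comparable y x"
  by (auto simp: comparable_def)

text \<open>If \<open>y\<close> lies between \<open>x\<close> and \<open>z\<close>, transitivity of
  the order suffices; if it lies below both or above both, forward or backward comparability at the
  core point \<open>y\<close> applies.\<close>

lemma comparable_trans:
  assumes "x \<in> H" "y \<in> core" "z \<in> H" "comparable x y" "comparable y z"
  shows "comparable x z"
  using assms forward_comparable[of y x z] backward_comparable[of y x z]
    le_trans[of x y z] le_trans[of z y x]
  unfolding comparable_def by blast

end

section \<open>A Borel parametrisation of the leaves\<close>

text \<open>Projections of Borel sets need not be Borel. Sigma-compact sets are stable under
  continuous images and are Borel in Hausdorff spaces, so projections of closed relations can be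
  handled.\<close>

definition sigma_compact :: "'a::topological_space set \<Rightarrow> bool" where
  "sigma_compact S \<longleftrightarrow> (\<exists>\<K>. countable \<K> \<and> (\<forall>K\<in>\<K>. compact K) \<and> S = \<Union>\<K>)"

lemma sigma_compact_UN:
  assumes "countable I" "\<And>i. i \<in> I \<Longrightarrow> sigma_compact (S i)"
  shows "sigma_compact (\<Union>i\<in>I. S i)"
proof -
  obtain \<K> where \<K>: "\<And>i. i \<in> I \<Longrightarrow> countable (\<K> i) \<and> (\<forall>K\<in>\<K> i. compact K) \<and> S i = \<Union>(\<K> i)"
    using assms(2) unfolding sigma_compact_def by metis
  show ?thesis
    unfolding sigma_compact_def
  proof (intro exI conjI)
    show "countable (\<Union>i\<in>I. \<K> i)"
      using assms(1) \<K> by auto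
    show "\<forall>K\<in>(\<Union>i\<in>I. \<K> i). compact K" "(\<Union>i\<in>I. S i) = \<Union>(\<Union>i\<in>I. \<K> i)"
      using \<K> by auto
  qed
qed

lemma compact_imp_sigma_compact: "compact K \<Longrightarrow> sigma_compact K"
  unfolding sigma_compact_def by (intro exI[of _ "{K}"]) auto

lemma sigma_compact_Un: "sigma_compact S \<Longrightarrow> sigma_compact T \<Longrightarrow> sigma_compact (S \<union> T)"
  using sigma_compact_UN[of "{S, T}" "\<lambda>A. A"] by auto

lemma sigma_compact_image:
  assumes "sigma_compact S" "continuous_on UNIV f"
  shows "sigma_compact (f ` S)"
proof -
  obtain \<K> where "countable \<K>" "\<forall>K\<in>\<K>. compact K" "S = \<Union>\<K>"
    using assms(1) unfolding sigma_compact_def by blast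
  moreover from this have "compact (f ` K)" if "K \<in> \<K>" for K
    using that compact_continuous_image continuous_on_subset[OF assms(2)] by blast
  ultimately show ?thesis
    unfolding sigma_compact_def by (intro exI[of _ "(`) f ` \<K>"]) auto
qed

lemma sigma_compact_Int_closed:
  assumes "sigma_compact S" "closed C"
  shows "sigma_compact (S \<inter> C)"
proof -
  obtain \<K> where "countable \<K>" "\<forall>K\<in>\<K>. compact K" "S = \<Union>\<K>"
    using assms(1) unfolding sigma_compact_def by blast
  then show ?thesis
    unfolding sigma_compact_def using assms(2)
    by (intro exI[of _ "(\<lambda>K. K \<inter> C) ` \<K>"]) (auto intro: compact_Int_closed)
qed

lemma sigma_compact_Int:
  fixes S T :: "'a::t2_space set"
  assumes "sigma_compact S" "sigma_compact T"
  shows "sigma_compact (S \<inter> T)"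
proof -
  obtain \<K> where \<K>: "countable \<K>" "\<forall>K\<in>\<K>. compact K" "T = \<Union>\<K>"
    using assms(2) unfolding sigma_compact_def by blast
  have "sigma_compact (\<Union>K\<in>\<K>. S \<inter> K)"
    using \<K> by (intro sigma_compact_UN sigma_compact_Int_closed assms compact_imp_closed) auto
  moreover have "S \<inter> T = (\<Union>K\<in>\<K>. S \<inter> K)" using \<K>(3) by blast
  ultimately show ?thesis by (simp only:)
qed

lemma sigma_compact_Times:
  assumes "sigma_compact S" "sigma_compact T"
  shows "sigma_compact (S \<times> T)"
proof -
  obtain \<K> where \<K>: "countable \<K>" "\<forall>K\<in>\<K>. compact K" "S = \<Union>\<K>"
    using assms(1) unfolding sigma_compact_def by blast
  obtain \<L> where \<L>: "countable \<L>" "\<forall>K\<in>\<L>. compact K" "T = \<Union>\<L>"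
    using assms(2) unfolding sigma_compact_def by blast
  have "sigma_compact (\<Union>(K, L)\<in>\<K> \<times> \<L>. K \<times> L)"
    using \<K> \<L> by (intro sigma_compact_UN compact_imp_sigma_compact) (auto intro: compact_Times)
  moreover have "(\<Union>(K, L)\<in>\<K> \<times> \<L>. K \<times> L) = S \<times> T"
    unfolding \<K> \<L> by auto
  ultimately show ?thesis by simp
qed

lemma sigma_compact_borel:
  fixes S :: "'a::t2_space set"
  assumes "sigma_compact S"
  shows "S \<in> sets borel"
proof -
  obtain \<K> where \<K>: "countable \<K>" "\<forall>K\<in>\<K>. compact K" "S = \<Union>\<K>"
    using assms unfolding sigma_compact_def by blast
  have "\<K> \<subseteq> sets borel"
    using \<K>(2) borel_compact by blast
  then show ?thesis
    unfolding \<K>(3) using \<K>(1) by (intro sets.countable_Union)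
qed

context gauged_null_set
begin

section \<open>Borel measurability of the core and separation of the leaves\<close>

lemma sigma_compact_UNIV: "sigma_compact (UNIV :: 'a set)"
proof -
  fix o' :: 'a
  have "(UNIV :: 'a set) = (\<Union>n. cball o' (real n))"
    using real_arch_simple by (auto simp: dist_commute)
  moreover have "sigma_compact (\<Union>n. cball o' (real n))"
    by (intro sigma_compact_UN compact_imp_sigma_compact proper) auto
  ultimately show ?thesis by simp
qed

text \<open>The condition \<open>x \<noteq> y\<close> is not closed; it is exhausted by the closed
  conditions that the distance be at least \<open>1 / real (Suc n)\<close>.\<close>

lemma sigma_compact_strict_causal_rel:
  "sigma_compact {(x, y). x \<in> H \<and> y \<in> H \<and> le x y \<and> x \<noteq> y}" (is "sigma_compact ?R")
proof -
  define C where "C n = (H \<times> H \<inter> causal_rel le) \<inter> {p. 1 / real (Suc n) \<le> dist (fst p) (snd p)}" for n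
  have "closed (C n)" for n
    unfolding C_def
    by (intro closed_Int closed_Times closed_H closed_le closed_Collect_le continuous_intros)
  then have "sigma_compact (UNIV \<times> UNIV \<inter> C n)" for n
    by (intro sigma_compact_Int_closed sigma_compact_Times sigma_compact_UNIV)
  then have "sigma_compact (\<Union>n. C n)"
    by (intro sigma_compact_UN) auto
  moreover have "(\<Union>n. C n) = ?R"
  proof (intro equalityI subsetI)
    fix p assume "p \<in> ?R"
    moreover from this have "0 < dist (fst p) (snd p)" by auto
    then obtain n where "1 / real (Suc n) < dist (fst p) (snd p)"
      using nat_approx_posE by blast
    ultimately show "p \<in> (\<Union>n. C n)"
      by (auto simp: C_def causal_rel_def intro!: exI[of _ n])
  next
    fix p assume "p \<in> (\<Union>n. C n)"
    then obtain n where "p \<in> C n" by blast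
    moreover from this have "fst p \<noteq> snd p"
      by (auto simp: C_def not_le)
    ultimately show "p \<in> ?R"
      by (auto simp: C_def causal_rel_def)
  qed
  ultimately show ?thesis by simp
qed

text \<open>Core points are those with a strict predecessor and a strict successor in
  \<open>H\<close>, so the core is the intersection of the two projections of the strict
  relation.\<close>

lemma sigma_compact_core: "sigma_compact core"
proof -
  let ?R = "{(x, y). x \<in> H \<and> y \<in> H \<and> le x y \<and> x \<noteq> y}"
  have "snd ` ?R = {y \<in> H. \<exists>x\<in>H. le x y \<and> x \<noteq> y}" "fst ` ?R = {x \<in> H. \<exists>y\<in>H. le x y \<and> x \<noteq> y}"
    by force+
  then have "core = snd ` ?R \<inter> fst ` ?R"
    unfolding inner_part_def initial_points_def final_points_def by auto
  then show ?thesis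
    by (simp only:)
       (intro sigma_compact_Int sigma_compact_image sigma_compact_strict_causal_rel continuous_intros)
qed

lemma core_borel: "core \<in> sets borel"
  by (intro sigma_compact_borel sigma_compact_core)

text \<open>For \<open>S\<close> inside the core, its trace on the core is the union of the leaves
  that meet \<open>S\<close>.\<close>

definition saturation :: "'a set \<Rightarrow> 'a set" where
  "saturation S = {z. \<exists>x\<in>S. comparable x z}"

lemma saturation_borel:
  assumes "sigma_compact S"
  shows "saturation S \<in> sets borel"
proof -
  have "saturation S = snd ` ((S \<times> UNIV) \<inter> causal_rel le) \<union> fst ` ((UNIV \<times> S) \<inter> causal_rel le)"
    unfolding saturation_def comparable_def causal_rel_def by force
  moreover have "sigma_compact \<dots>"
    by (intro sigma_compact_Un sigma_compact_image sigma_compact_Int_closed closed_le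
        sigma_compact_Times sigma_compact_UNIV assms continuous_intros)
  ultimately show ?thesis
    using sigma_compact_borel by simp
qed

lemma closed_comparable: "closed {z. comparable y z}"
proof -
  have "closed {z. (y, z) \<in> causal_rel le}" "closed {z. (z, y) \<in> causal_rel le}"
    using closed_vimage[OF closed_le, of "\<lambda>z. (y, z)"] closed_vimage[OF closed_le, of "\<lambda>z. (z, y)"]
    by (simp_all add: vimage_def continuous_intros)
  from closed_Un[OF this] show ?thesis
    by (simp add: causal_rel_def comparable_def Collect_disj_eq)
qed

text \<open>The leaves are separated by the saturations of countably many balls, because the set of
  points comparable to a given one is closed.\<close>

lemma exists_leaf_map:
  obtains \<Phi> :: "'a \<Rightarrow> nat \<Rightarrow> real" where "\<Phi> \<in> borel_measurable borel"
    "\<forall>x\<in>core. \<forall>y\<in>core. \<Phi> x = \<Phi> y \<longleftrightarrow> comparable x y"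
proof -
  obtain D :: "'a set" where D: "countable D" "\<And>X. open X \<Longrightarrow> X \<noteq> {} \<Longrightarrow> \<exists>d\<in>D. d \<in> X"
    using countable_dense_exists by blast
  define B where "B = (\<lambda>(d, n). saturation (core \<inter> cball d (1 / real (Suc n)))) ` (D \<times> UNIV)"
  have B: "countable B" "B \<noteq> {}"
    using D(1) D(2)[OF open_UNIV] by (auto simp: B_def)
  \<comment> \<open>The sequence of indicators records which saturations contain the point; its
    values lie in a Polish space.\<close>
  define \<Phi> :: "'a \<Rightarrow> nat \<Rightarrow> real" where "\<Phi> x n = indicator (from_nat_into B n) x" for x n
  have "S \<in> sets borel" if "S \<in> B" for S
    using that
    by (auto simp: B_def intro!: saturation_borel sigma_compact_Int_closed sigma_compact_core)
  then have "\<Phi> \<in> borel_measurable borel"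
    unfolding \<Phi>_def using from_nat_into[OF B(2)]
    by (intro measurable_coordinatewise_then_product borel_measurable_indicator) auto
  moreover have "\<Phi> x = \<Phi> y \<longleftrightarrow> comparable x y" if xy: "x \<in> core" "y \<in> core" for x y
  proof
    assume "comparable x y"
    \<comment> \<open>Comparable core points are comparable to the same core points, hence lie in
      the same saturations.\<close>
    then have "comparable z x \<longleftrightarrow> comparable z y" if "z \<in> core" for z
      using that xy core_subset comparable_sym[of x y] comparable_trans[of z x y]
        comparable_trans[of z y x] by blast
    then have "x \<in> S \<longleftrightarrow> y \<in> S" if "S \<in> B" for S
      using that by (auto simp: B_def saturation_def)
    then show "\<Phi> x = \<Phi> y"
      using from_nat_into[OF B(2)] by (intro ext) (auto simp: \<Phi>_def indicator_def)
  next
    assume eq: "\<Phi> x = \<Phi> y"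
    show "comparable x y"
    proof (rule ccontr)
      assume "\<not> comparable x y"
      then have "x \<in> - {z. comparable y z}"
        using comparable_sym[of y x] by auto
      then obtain e where e: "e > 0" "ball x e \<subseteq> - {z. comparable y z}"
        using closed_comparable[of y] open_contains_ball unfolding closed_def by blast
      \<comment> \<open>A ball of radius below \<open>e / 2\<close> whose centre is that close to
        \<open>x\<close> lies in \<open>ball x e\<close>, so none of its points is comparable to
        \<open>y\<close>; its saturation therefore separates \<open>x\<close> from
        \<open>y\<close>.\<close>
      obtain n where n: "1 / real (Suc n) < e / 2"
        using nat_approx_posE[of "e / 2"] e by auto
      obtain d where d: "d \<in> D" "d \<in> ball x (1 / real (Suc n))"
        using D(2)[of "ball x (1 / real (Suc n))"] by auto
      let ?S = "saturation (core \<inter> cball d (1 / real (Suc n)))"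
      have "?S \<in> B"
        using d by (auto simp: B_def)
      then obtain k where k: "from_nat_into B k = ?S"
        using from_nat_into_surj[OF B(1)] by blast
      have "x \<in> ?S"
        using xy d comparable_refl[of x]
        by (auto simp: saturation_def dist_commute intro!: bexI[of _ x])
      then have "y \<in> ?S"
        using fun_cong[OF eq, of k] k by (auto simp: \<Phi>_def indicator_def split: if_splits)
      then obtain z where z: "dist d z \<le> 1 / real (Suc n)" "comparable z y"
        by (auto simp: saturation_def)
      have "dist x z < e"
        using dist_triangle[of x z d] d z n by auto
      then show False
        using e z comparable_sym[of z y] by auto
    qed
  qed
  ultimately show thesis by (intro that ballI)
qed

end

section \<open>Consequences of inner regularity\<close>

lemma finite_borel_measure_inner_compact:
  fixes M :: "'a::{second_countable_topology, complete_space} measure"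
  assumes "finite_measure M" "sets M = sets borel" "A \<in> sets borel" "0 < e"
  obtains K where "compact K" "K \<subseteq> A" "measure M (A - K) < e"
proof -
  interpret finite_measure M by fact
  show thesis
  proof (cases "measure M A < e")
    case True
    then show ?thesis using that[of "{}"] by simp
  next
    case False
    then have "ennreal (measure M A - e) < emeasure M A"
      using assms(4) by (simp add: emeasure_eq_measure ennreal_less_iff)
    also have "emeasure M A = (SUP K \<in> {K. K \<subseteq> A \<and> compact K}. emeasure M K)"
      using assms by (intro inner_regular) (auto simp: emeasure_eq_measure)
    finally obtain K where K: "K \<subseteq> A" "compact K" "ennreal (measure M A - e) < emeasure M K"
      by (auto simp: less_SUP_iff)
    then have "measure M A - e < measure M K"
      using False by (simp add: emeasure_eq_measure ennreal_less_iff)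
    moreover have "measure M (A - K) = measure M A - measure M K"
      using K assms by (intro finite_measure_Diff) (auto intro: borel_compact)
    ultimately show ?thesis using that[of K] K by simp
  qed
qed

text \<open>For each basic open \<open>U n\<close>, the parts of \<open>S\<close> inside and outside
  its preimage are approximated by compact sets \<open>C n\<close> and \<open>D n\<close>. On the
  intersection \<open>K\<close> of all \<open>C n \<union> D n\<close>, the preimage of
  \<open>U n\<close> is the part outside the closed set \<open>D n\<close>, so it is relatively
  open.\<close>

lemma lusin_compact:
  fixes M :: "'a::{second_countable_topology, complete_space} measure" and f :: "'a \<Rightarrow> 'b::second_countable_topology"
  assumes M: "finite_measure M" "sets M = sets borel" and f: "f \<in> borel_measurable borel"
    and S: "S \<in> sets borel" and e: "0 < e"
  obtains K where "compact K" "K \<subseteq> S" "continuous_on K f" "measure M (S - K) \<le> e"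
proof -
  interpret finite_measure M by fact
  obtain B :: "'b set set" where B: "countable B" "topological_basis B"
    using ex_countable_basis by blast
  have "B \<noteq> {}"
    using B(2) by (metis UNIV_I empty_iff open_UNIV topological_basisE)
  define U where "U = from_nat_into B"
  have U: "open (U n)" for n
    using B \<open>B \<noteq> {}\<close> by (metis U_def from_nat_into topological_basis_open)
  have U_basis: "\<exists>n. y \<in> U n \<and> U n \<subseteq> V" if "open V" "y \<in> V" for y V
    using that B by (metis U_def from_nat_into_surj topological_basisE)
  \<comment> \<open>Two errors \<open>d n\<close> make \<open>e * (1/2) ^ Suc n\<close>, and these
    sum to \<open>e\<close>.\<close>
  define d where "d n = e * (1/2) ^ Suc (Suc n)" for n
  have d: "0 < d n" for n using e by (simp add: d_def)
  have meas: "S \<inter> f -` U n \<in> sets borel" "S - f -` U n \<in> sets borel" for n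
    using measurable_sets_borel[OF f, of "U n"] U[of n] S by auto
  have "\<exists>C. compact C \<and> C \<subseteq> S \<inter> f -` U n \<and> measure M ((S \<inter> f -` U n) - C) < d n" for n
    using finite_borel_measure_inner_compact[OF M meas(1) d] by metis
  then obtain C where C: "\<And>n. compact (C n)" "\<And>n. C n \<subseteq> S \<inter> f -` U n"
    "\<And>n. measure M ((S \<inter> f -` U n) - C n) < d n" by metis
  have "\<exists>D. compact D \<and> D \<subseteq> S - f -` U n \<and> measure M ((S - f -` U n) - D) < d n" for n
    using finite_borel_measure_inner_compact[OF M meas(2) d] by metis
  then obtain D where D: "\<And>n. compact (D n)" "\<And>n. D n \<subseteq> S - f -` U n"
    "\<And>n. measure M ((S - f -` U n) - D n) < d n" by metis
  define K where "K = (\<Inter>n. C n \<union> D n)"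
  have KS: "K \<subseteq> S" using C(2) D(2) by (fastforce simp: K_def)
  have CD: "compact (C n \<union> D n)" for n
    using C(1) D(1) by (rule compact_Un)
  have "compact ((C 0 \<union> D 0) \<inter> K)"
    unfolding K_def by (intro compact_Int_closed closed_INT ballI compact_imp_closed CD)
  moreover have "(C 0 \<union> D 0) \<inter> K = K"
    unfolding K_def by blast
  ultimately have "compact K" by simp
  moreover have "continuous_on K f"
    unfolding continuous_on_topological
  proof (intro ballI allI impI)
    fix x V assume x: "x \<in> K" "open V" "f x \<in> V"
    obtain n where n: "f x \<in> U n" "U n \<subseteq> V"
      using U_basis x by blast
    show "\<exists>A. open A \<and> x \<in> A \<and> (\<forall>y\<in>K. y \<in> A \<longrightarrow> f y \<in> V)"
    proof (intro exI[of _ "- D n"] conjI ballI impI)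
      show "open (- D n)" using compact_imp_closed[OF D(1)] by auto
      show "x \<in> - D n" using n D(2)[of n] by auto
      fix y assume "y \<in> K" "y \<in> - D n"
      then have "y \<in> C n" by (auto simp: K_def)
      then show "f y \<in> V" using C(2)[of n] n by auto
    qed
  qed
  moreover have "measure M (S - K) \<le> e"
  proof -
    have sets: "C n \<in> sets M" "D n \<in> sets M" for n
      using C(1) D(1) M(2) by (auto intro: borel_compact)
    have S': "S - (C n \<union> D n) \<in> sets M" for n
      using sets[of n] S M(2) by auto
    have le: "measure M (S - (C n \<union> D n)) \<le> e * (1/2) ^ Suc n" for n
    proof -
      have "S - (C n \<union> D n) \<subseteq> ((S \<inter> f -` U n) - C n) \<union> ((S - f -` U n) - D n)" by auto
      then have "measure M (S - (C n \<union> D n)) \<le>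
          measure M (((S \<inter> f -` U n) - C n) \<union> ((S - f -` U n) - D n))"
        using meas sets M by (intro finite_measure_mono) auto
      also have "\<dots> \<le> measure M ((S \<inter> f -` U n) - C n) + measure M ((S - f -` U n) - D n)"
        using meas sets M by (intro measure_Un_le) auto
      also have "\<dots> \<le> e * (1/2) ^ Suc n"
        using C(3)[of n] D(3)[of n] by (simp add: d_def)
      finally show ?thesis .
    qed
    have sums: "(\<lambda>n. e * (1/2) ^ Suc n) sums e"
      using sums_mult[OF power_half_series, of e] by simp
    have "summable (\<lambda>n. measure M (S - (C n \<union> D n)))"
      using le by (intro summable_comparison_test'[OF sums_summable[OF sums], of 0]) auto
    have "S - K = (\<Union>n. S - (C n \<union> D n))" by (auto simp: K_def)
    then have "measure M (S - K) \<le> (\<Sum>n. measure M (S - (C n \<union> D n)))"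
      using S' \<open>summable _\<close> by (simp only:) (intro finite_measure_subadditive_countably image_subsetI)
    also have "\<dots> \<le> (\<Sum>n. e * (1/2) ^ Suc n)"
      using le \<open>summable _\<close> sums_summable[OF sums] by (intro suminf_le) auto
    also have "\<dots> = e" using sums by (simp add: sums_iff)
    finally show ?thesis .
  qed
  ultimately show thesis using that KS by blast
qed

text \<open>Letting the error tend to \<open>0\<close> exhausts \<open>S\<close> up to a null set by
  compact pieces on which \<open>f\<close> is continuous. Their images are compact, so the image of
  their union is Borel, which is not guaranteed for the image of \<open>S\<close> itself.\<close>

lemma lusin_cover:
  fixes M :: "'a::{second_countable_topology, complete_space} measure" and f :: "'a \<Rightarrow> 'b::second_countable_topology"
  assumes M: "finite_measure M" "sets M = sets borel" and f: "f \<in> borel_measurable borel"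
    and S: "S \<in> sets borel"
  obtains \<K> where "countable \<K>" "\<forall>K\<in>\<K>. compact K" "\<forall>K\<in>\<K>. continuous_on K f"
    "\<Union>\<K> \<subseteq> S" "AE x in M. x \<in> S \<longrightarrow> x \<in> \<Union>\<K>"
proof -
  interpret finite_measure M by fact
  have "\<exists>K. compact K \<and> K \<subseteq> S \<and> continuous_on K f \<and> measure M (S - K) \<le> 1 / real (Suc n)" for n
    using lusin_compact[OF M f S, of "1 / real (Suc n)"] by (metis of_nat_0_less_iff zero_less_Suc zero_less_divide_1_iff)
  then obtain K where K: "\<And>n. compact (K n)" "\<And>n. K n \<subseteq> S" "\<And>n. continuous_on (K n) f"
    "\<And>n. measure M (S - K n) \<le> 1 / real (Suc n)" by metis
  have sets: "K n \<in> sets M" for n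
    using K(1) M(2) by (auto intro: borel_compact)
  have N: "S - (\<Union>n. K n) \<in> sets M"
    using S sets M(2) by auto
  have "measure M (S - (\<Union>n. K n)) \<le> 1 / real (Suc n)" for n
  proof -
    have "measure M (S - (\<Union>n. K n)) \<le> measure M (S - K n)"
      using S sets M(2) by (intro finite_measure_mono) auto
    with K(4)[of n] show ?thesis by simp
  qed
  then have "measure M (S - (\<Union>n. K n)) \<le> 0"
    by (metis nat_approx_posE not_le)
  then have "emeasure M (S - (\<Union>n. K n)) = 0"
    by (simp add: emeasure_eq_measure measure_le_0_iff)
  then have "AE x in M. x \<notin> S - (\<Union>n. K n)"
    using N by (intro AE_not_in null_setsI)
  then have "AE x in M. x \<in> S \<longrightarrow> x \<in> \<Union>(range K)"
    by eventually_elim auto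
  with K show thesis
    by (intro that[of "range K"]) auto
qed

text \<open>The preimage of a closed set under the inverse is, within the image of \<open>f\<close>,
  the image of a countable union of compact sets on which \<open>f\<close> is continuous, hence
  Borel.\<close>

lemma borel_left_inverse:
  fixes f :: "'a::t2_space \<Rightarrow> 'b::t2_space"
  assumes \<K>: "countable \<K>" "\<forall>K\<in>\<K>. compact K" "\<forall>K\<in>\<K>. continuous_on K f"
    and inj: "inj_on f (\<Union>\<K>)"
  obtains h where "h \<in> borel_measurable borel" "\<forall>x\<in>\<Union>\<K>. h (f x) = x"
proof -
  have borel: "(\<Union>K\<in>\<K>. f ` (K \<inter> C)) \<in> sets borel" if "closed C" for C
  proof -
    have "compact (f ` (K \<inter> C))" if "K \<in> \<K>" for K
      using \<K>(2,3) that \<open>closed C\<close>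
      by (intro compact_continuous_image compact_Int_closed)
         (auto intro: continuous_on_subset)
    then show ?thesis
      using \<K>(1) borel_compact by (intro sets.countable_UN') blast+
  qed
  \<comment> \<open>Off the image \<open>h\<close> is the constant \<open>undefined\<close>, so the
    preimage of \<open>C\<close> gains the whole complement of the image exactly when that value
    lies in \<open>C\<close>.\<close>
  define h where "h y = (if y \<in> f ` \<Union>\<K> then inv_into (\<Union>\<K>) f y else undefined)" for y
  have h: "h (f x) = x" if "x \<in> \<Union>\<K>" for x
    using that inj by (auto simp: h_def)
  have closed: "h -` C \<in> sets borel" if C: "closed C" for C
  proof -
    have "h -` C = (\<Union>K\<in>\<K>. f ` (K \<inter> C)) \<union> (if undefined \<in> C then - f ` \<Union>\<K> else {})" (is "_ = ?R")
    proof (intro set_eqI)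
      fix y show "y \<in> h -` C \<longleftrightarrow> y \<in> ?R"
      proof (cases "y \<in> f ` \<Union>\<K>")
        case True
        then obtain x where x: "x \<in> \<Union>\<K>" "y = f x" by blast
        have "y \<in> ?R \<longleftrightarrow> y \<in> (\<Union>K\<in>\<K>. f ` (K \<inter> C))"
          using True by auto
        also have "\<dots> \<longleftrightarrow> (\<exists>x'\<in>\<Union>\<K>. x' \<in> C \<and> f x' = y)"
          by blast
        also have "\<dots> \<longleftrightarrow> x \<in> C"
          using x inj by (auto dest: inj_onD)
        finally show ?thesis using h x by auto
      next
        case False
        then show ?thesis by (auto simp: h_def)
      qed
    qed
    moreover have "f ` \<Union>\<K> \<in> sets borel"
      using borel[OF closed_UNIV] by (simp add: image_Union)
    then have "(if undefined \<in> C then - f ` \<Union>\<K> else {}) \<in> sets borel"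
      using borel_comp by simp
    ultimately show ?thesis
      using borel[OF C] by (simp only:) (rule sets.Un)
  qed
  have "h \<in> borel_measurable borel"
  proof (rule borel_measurableI)
    fix V :: "'a set" assume "open V"
    then have "h -` (- V) \<in> sets borel" by (intro closed) auto
    then have "- (h -` (- V)) \<in> sets borel" by (rule borel_comp)
    then show "h -` V \<inter> space borel \<in> sets borel" by (simp add: vimage_Compl)
  qed
  then show thesis using h that by blast
qed

text \<open>These products form an intersection-stable generator of the product Borel sets, and
  those with \<open>UNIV\<close> and natural \<open>t\<close> exhaust the space.\<close>

lemma borel_measure_eqI_Times_lessThan:
  fixes M N :: "('c::second_countable_topology \<times> real) measure"
  assumes M: "finite_measure M" "sets M = sets borel" and N: "sets N = sets borel"
    and eq: "\<And>B t. B \<in> sets borel \<Longrightarrow> emeasure M (B \<times> {..<t}) = emeasure N (B \<times> {..<t})"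
  shows "M = N"
proof -
  interpret finite_measure M by fact
  let ?E = "{a \<times> b | a b. a \<in> sets (borel :: 'c measure) \<and> b \<in> range (lessThan :: real \<Rightarrow> _)}"
  have un: "(\<Union>n. {..<real n}) = (UNIV :: real set)"
    using reals_Archimedean2 by auto
  have "sets (borel :: ('c \<times> real) measure) = sets (sigma (space borel \<times> space borel) ?E)"
    unfolding borel_prod[symmetric]
  proof (rule sets_pair_eq)
    show "sets (borel :: 'c measure) = sigma_sets (space borel) (sets borel)"
      by (simp add: sets.sigma_sets_eq[of borel, simplified])
    show "sets (borel :: real measure) = sigma_sets (space borel) (range lessThan)"
      by (subst borel_Iio) simp
    show "countable {UNIV :: 'c set}" "{UNIV} \<subseteq> sets (borel :: 'c measure)"
      "\<Union>{UNIV} = space (borel :: 'c measure)" by auto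
    show "countable (range (\<lambda>n. {..<real n}))" "range (\<lambda>n. {..<real n}) \<subseteq> range lessThan"
      "\<Union>(range (\<lambda>n. {..<real n})) = space borel" using un by auto
  qed auto
  then have gen: "sets (borel :: ('c \<times> real) measure) = sigma_sets UNIV ?E"
    by simp
  show ?thesis
  proof (rule measure_eqI_generator_eq[where E = ?E and \<Omega> = UNIV and A = "\<lambda>n. UNIV \<times> {..<real n}"])
    show "Int_stable ?E"
    proof (rule Int_stableI)
      fix X Y assume "X \<in> ?E" "Y \<in> ?E"
      then obtain a s b t where "X = a \<times> {..<s}" "Y = b \<times> {..<t}" "a \<in> sets borel" "b \<in> sets borel"
        by auto
      moreover from this have "X \<inter> Y = (a \<inter> b) \<times> {..<min s t}" by auto
      ultimately show "X \<inter> Y \<in> ?E" by blast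
    qed
    show "range (\<lambda>n. UNIV \<times> {..<real n}) \<subseteq> ?E"
      by (intro image_subsetI CollectI exI conjI refl rangeI) auto
    show "(\<Union>n. UNIV \<times> {..<real n}) = (UNIV :: ('c \<times> real) set)" using un by auto
    show "sets M = sigma_sets UNIV ?E" "sets N = sigma_sets UNIV ?E"
      using M N gen by (simp_all only:)
    show "emeasure M X = emeasure N X" if "X \<in> ?E" for X
      using that eq by auto
  qed auto
qed

section \<open>Conditional quantile functions\<close>

lemma borel_measurable_fst_borel [measurable]: "fst \<in> borel_measurable borel"
  and borel_measurable_snd_borel [measurable]: "snd \<in> borel_measurable borel"
  by (intro borel_measurable_continuous_onI continuous_intros)+

text \<open>The inequality of integrals is tested on the set where \<open>g < f\<close>; finiteness
  of the integral of \<open>g\<close> makes the comparison strict if that set is not null.\<close>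

lemma AE_le_if_set_nn_integral_le:
  fixes f g :: "'a \<Rightarrow> ennreal"
  assumes [measurable]: "f \<in> borel_measurable M" "g \<in> borel_measurable M"
    and le: "\<And>A. A \<in> sets M \<Longrightarrow> (\<integral>\<^sup>+x\<in>A. f x \<partial>M) \<le> (\<integral>\<^sup>+x\<in>A. g x \<partial>M)"
    and fin: "(\<integral>\<^sup>+x. g x \<partial>M) \<noteq> \<infinity>"
  shows "AE x in M. f x \<le> g x"
proof (rule ccontr)
  assume not_le: "\<not> (AE x in M. f x \<le> g x)"
  define A where "A = {x \<in> space M. g x < f x}"
  have A[measurable]: "A \<in> sets M" by (simp add: A_def)
  have "(\<integral>\<^sup>+x\<in>A. g x \<partial>M) < (\<integral>\<^sup>+x\<in>A. f x \<partial>M)"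
  proof (rule nn_integral_less)
    have "(\<integral>\<^sup>+x\<in>A. g x \<partial>M) \<le> (\<integral>\<^sup>+x. g x \<partial>M)"
      by (intro nn_integral_mono) (simp add: indicator_def)
    then show "(\<integral>\<^sup>+x\<in>A. g x \<partial>M) \<noteq> \<infinity>"
      using fin by (auto simp: top_unique)
    show "AE x in M. g x * indicator A x \<le> f x * indicator A x"
      by (intro AE_I2) (auto simp: A_def indicator_def)
    show "\<not> (AE x in M. f x * indicator A x \<le> g x * indicator A x)"
    proof
      assume "AE x in M. f x * indicator A x \<le> g x * indicator A x"
      then have "AE x in M. f x \<le> g x"
        using AE_space
      proof eventually_elim
        case (elim x)
        then show ?case by (cases "g x < f x") (auto simp: A_def)
      qed
      with not_le show False ..
    qed
  qed auto
  with le[OF A] show False by simp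
qed

definition unit_uniform :: "real measure" where
  "unit_uniform = uniform_measure lborel {0..1}"

lemma prob_space_unit_uniform: "prob_space unit_uniform"
  unfolding unit_uniform_def by (rule prob_space_uniform_measure) auto

lemma sets_unit_uniform [simp, measurable_cong]: "sets unit_uniform = sets borel"
  by (simp add: unit_uniform_def)

lemma space_unit_uniform [simp]: "space unit_uniform = UNIV"
  by (simp add: unit_uniform_def)

lemma emeasure_unit_uniform_less:
  assumes "x \<le> 1"
  shows "emeasure unit_uniform {u. ennreal u < x} = x"
proof -
  obtain r where r: "x = ennreal r" "0 \<le> r" "r \<le> 1"
    using assms by (cases x) (auto simp: top_unique)
  \<comment> \<open>Negative \<open>u\<close> become \<open>0\<close> under \<open>ennreal\<close>,
    but the uniform measure sees only the unit interval.\<close>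
  have "{0..1} \<inter> {u. ennreal u < x} = {0..<r}"
    using r by (auto simp: ennreal_less_iff)
  moreover have "{u. ennreal u < x} \<in> sets borel" by measurable
  ultimately show ?thesis
    using r by (simp add: unit_uniform_def divide_ennreal_def)
qed

text \<open>The conditional probability that the second coordinate is below \<open>r\<close>, given
  the first: the density of \<open>B \<mapsto> \<nu> (B \<times> {..<r})\<close> with respect to the
  first marginal. It is determined only almost everywhere, separately for each
  \<open>r\<close>.\<close>

definition cond_cdf :: "('c::topological_space \<times> real) measure \<Rightarrow> real \<Rightarrow> 'c \<Rightarrow> ennreal" where
  "cond_cdf \<nu> r = RN_deriv (distr \<nu> borel fst)
     (distr (density \<nu> (indicator (UNIV \<times> {..<r}))) borel fst)"

text \<open>A generalised inverse of the conditional distribution function. Rational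
  \<open>r\<close> allow the almost-everywhere facts to be used simultaneously; the inserted
  \<open>1\<close> and the bounds on \<open>r\<close> keep the infimum in the unit interval.\<close>

definition cond_quantile :: "('c::topological_space \<times> real) measure \<Rightarrow> 'c \<Rightarrow> real \<Rightarrow> real" where
  "cond_quantile \<nu> a u = Inf (insert 1 {r \<in> \<rat>. 0 \<le> r \<and> r \<le> 1 \<and> ennreal u < cond_cdf \<nu> r a})"

lemma borel_measurable_cond_cdf [measurable]: "cond_cdf \<nu> r \<in> borel_measurable borel"
  using borel_measurable_RN_deriv[of "distr \<nu> borel fst"] by (simp add: cond_cdf_def)

text \<open>The measure \<open>B \<mapsto> \<nu> (B \<times> {..<r})\<close> is dominated by the
  first marginal, so the Radon-Nikodym theorem applies.\<close>

lemma set_nn_integral_cond_cdf: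
  fixes \<nu> :: "('c::second_countable_topology \<times> real) measure"
  assumes "finite_measure \<nu>" and sets[measurable_cong]: "sets \<nu> = sets borel" and [measurable]: "B \<in> sets borel"
  shows "(\<integral>\<^sup>+a\<in>B. cond_cdf \<nu> r a \<partial>(distr \<nu> borel fst)) = emeasure \<nu> (B \<times> {..<r})"
proof -
  interpret finite_measure \<nu> by fact
  let ?l = "distr \<nu> borel fst"
  let ?n = "distr (density \<nu> (indicator (UNIV \<times> {..<r}))) borel fst"
  interpret l: finite_measure ?l
    by (rule finite_measure_distr) simp
  have n: "emeasure ?n A = emeasure \<nu> (A \<times> {..<r})" if [measurable]: "A \<in> sets borel" for A
  proof -
    have "emeasure ?n A = emeasure (density \<nu> (indicator (UNIV \<times> {..<r}))) (fst -` A)"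
      using sets_eq_imp_space_eq[OF sets] by (subst emeasure_distr) auto
    also have "\<dots> = emeasure \<nu> ((UNIV \<times> {..<r}) \<inter> fst -` A)"
      by (rule emeasure_restricted) (auto simp: sets intro!: borel_Times measurable_sets_borel[OF borel_measurable_fst_borel])
    also have "(UNIV \<times> {..<r}) \<inter> fst -` A = A \<times> {..<r}" by auto
    finally show ?thesis .
  qed
  have l: "emeasure ?l A = emeasure \<nu> (A \<times> UNIV)" if [measurable]: "A \<in> sets borel" for A
    using sets_eq_imp_space_eq[OF sets] by (subst emeasure_distr) (auto intro!: arg_cong2[where f = emeasure])
  have "absolutely_continuous ?l ?n"
    unfolding absolutely_continuous_def
  proof
    fix A assume A: "A \<in> null_sets ?l"
    then have [measurable]: "A \<in> sets borel" by auto
    have "emeasure \<nu> (A \<times> {..<r}) \<le> emeasure \<nu> (A \<times> UNIV)"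
      by (intro emeasure_mono) (auto simp: sets intro!: borel_Times)
    then have "emeasure ?n A = 0"
      using A l[of A] n[of A] by (simp add: null_setsD1)
    then show "A \<in> null_sets ?n" by auto
  qed
  then have "density ?l (cond_cdf \<nu> r) = ?n"
    unfolding cond_cdf_def by (rule l.density_RN_deriv) simp
  moreover have "emeasure (density ?l (cond_cdf \<nu> r)) B = (\<integral>\<^sup>+a\<in>B. cond_cdf \<nu> r a \<partial>?l)"
    by (rule emeasure_density) auto
  ultimately show ?thesis using n[of B] by simp
qed

lemma cond_quantile_bounds: "0 \<le> cond_quantile \<nu> a u" "cond_quantile \<nu> a u \<le> 1"
proof -
  let ?R = "insert 1 {r \<in> \<rat>. 0 \<le> r \<and> r \<le> 1 \<and> ennreal u < cond_cdf \<nu> r a}"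
  have "bdd_below ?R" by (rule bdd_belowI[of _ 0]) auto
  then show "cond_quantile \<nu> a u \<le> 1"
    unfolding cond_quantile_def by (intro cInf_lower) auto
  show "0 \<le> cond_quantile \<nu> a u"
    unfolding cond_quantile_def by (intro cInf_greatest) auto
qed

text \<open>More admissible \<open>r\<close> give a smaller infimum. This covers both monotonicity
  in the level \<open>u\<close> and the comparison of two measures.\<close>

lemma cond_quantile_mono_measure:
  assumes "\<And>r. r \<in> \<rat> \<Longrightarrow> ennreal u < cond_cdf \<nu>' r a \<Longrightarrow> ennreal v < cond_cdf \<nu> r a"
  shows "cond_quantile \<nu> a v \<le> cond_quantile \<nu>' a u"
  unfolding cond_quantile_def
  by (intro cInf_superset_mono) (auto intro: bdd_belowI[of _ 0] assms)

lemma cond_quantile_mono: "u \<le> v \<Longrightarrow> cond_quantile \<nu> a u \<le> cond_quantile \<nu> a v"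
  by (intro cond_quantile_mono_measure) (meson ennreal_leI order_le_less_trans)

text \<open>The supremum over rationals below \<open>t\<close> is the left-continuous regularisation
  of the distribution function. For \<open>t > 1\<close> the inserted \<open>1\<close> would make
  the left side always true.\<close>

lemma cond_quantile_less_iff:
  assumes "t \<le> 1"
  shows "cond_quantile \<nu> a u < t \<longleftrightarrow> ennreal u < (SUP r\<in>\<rat> \<inter> {0..<t}. cond_cdf \<nu> r a)"
proof -
  let ?R = "insert 1 {r \<in> \<rat>. 0 \<le> r \<and> r \<le> 1 \<and> ennreal u < cond_cdf \<nu> r a}"
  have "bdd_below ?R" by (rule bdd_belowI[of _ 0]) auto
  then have "cond_quantile \<nu> a u < t \<longleftrightarrow> (\<exists>r\<in>?R. r < t)"
    unfolding cond_quantile_def by (intro cInf_less_iff) auto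
  also have "\<dots> \<longleftrightarrow> (\<exists>r\<in>\<rat> \<inter> {0..<t}. ennreal u < cond_cdf \<nu> r a)"
    using assms by auto
  finally show ?thesis by (simp add: less_SUP_iff)
qed

lemma borel_measurable_cond_quantile [measurable]:
  fixes \<nu> :: "('c::second_countable_topology \<times> real) measure"
  shows "(\<lambda>p. cond_quantile \<nu> (fst p) (snd p)) \<in> borel_measurable borel"
proof (rule borel_measurable_iff_less[THEN iffD2], intro allI)
  fix t :: real
  have cnt: "countable (\<rat> \<inter> {0..<t})"
    by (intro countable_Int1 countable_rat)
  show "{p \<in> space borel. cond_quantile \<nu> (fst p) (snd p) < t} \<in> sets borel"
  proof (cases "t \<le> 1")
    case True
    have [measurable]: "(\<lambda>p. SUP r\<in>\<rat> \<inter> {0..<t}. cond_cdf \<nu> r (fst p)) \<in> borel_measurable (borel :: ('c \<times> real) measure)"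
      by (intro borel_measurable_SUP cnt) simp
    show ?thesis
      unfolding cond_quantile_less_iff[OF True] by measurable
  next
    case False
    then have "cond_quantile \<nu> a u < t" for a u
      using cond_quantile_bounds(2)[of \<nu> a u] by simp
    then show ?thesis by simp
  qed
qed

text \<open>Running maxima of an enumeration turn a supremum over rationals into one along an
  increasing sequence, as monotone convergence requires.\<close>

lemma exists_rat_incseq:
  fixes t :: real
  assumes "0 < t"
  obtains q where "incseq q" "\<And>n. q n \<in> \<rat> \<inter> {0..<t}" "\<And>x. x < t \<Longrightarrow> \<exists>n. x < q n"
proof -
  define R where "R = \<rat> \<inter> {0..<t}"
  have R: "R \<noteq> {}" "countable R"
    using assms by (auto simp: R_def intro: countable_Int1 countable_rat)
  define q where "q n = Max (from_nat_into R ` {..n})" for n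
  show thesis
  proof (rule that[of q])
    show "incseq q"
      unfolding q_def by (intro monoI Max_mono) auto
    show "q n \<in> \<rat> \<inter> {0..<t}" for n
    proof -
      have "q n \<in> from_nat_into R ` {..n}"
        unfolding q_def by (intro Max_in) auto
      then show ?thesis using from_nat_into[OF R(1)] by (auto simp: R_def)
    qed
    show "\<exists>n. x < q n" if x: "x < t" for x
    proof -
      obtain r where r: "r \<in> \<rat>" "max x 0 < r" "r < t"
        using Rats_dense_in_real[of "max x 0" t] x assms by auto
      then obtain n where "from_nat_into R n = r"
        using from_nat_into_surj[OF R(2), of r] by (auto simp: R_def)
      then have "r \<le> q n"
        unfolding q_def by (intro Max_ge) auto
      then show ?thesis using r by (intro exI[of _ n]) auto
    qed
  qed
qed

lemma AE_cond_cdf_le: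
  fixes \<nu> \<nu>' :: "('c::second_countable_topology \<times> real) measure"
  assumes \<nu>: "finite_measure \<nu>" "sets \<nu> = sets borel" and \<nu>': "finite_measure \<nu>'" "sets \<nu>' = sets borel"
    and marginal: "distr \<nu>' borel fst = distr \<nu> borel fst"
    and le: "\<And>B. B \<in> sets borel \<Longrightarrow> emeasure \<nu>' (B \<times> {..<r'}) \<le> emeasure \<nu> (B \<times> {..<r})"
  shows "AE a in distr \<nu> borel fst. cond_cdf \<nu>' r' a \<le> cond_cdf \<nu> r a"
proof (rule AE_le_if_set_nn_integral_le)
  show "(\<integral>\<^sup>+a. cond_cdf \<nu> r a \<partial>distr \<nu> borel fst) \<noteq> \<infinity>"
    using set_nn_integral_cond_cdf[OF \<nu>, of UNIV r] finite_measure.emeasure_finite[OF \<nu>(1)] by simp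
  show "(\<integral>\<^sup>+a\<in>A. cond_cdf \<nu>' r' a \<partial>distr \<nu> borel fst) \<le> (\<integral>\<^sup>+a\<in>A. cond_cdf \<nu> r a \<partial>distr \<nu> borel fst)"
    if "A \<in> sets (distr \<nu> borel fst)" for A
    using that le[of A] set_nn_integral_cond_cdf[OF \<nu>, of A r]
      set_nn_integral_cond_cdf[OF \<nu>', of A r'] marginal by simp
qed simp_all


text \<open>Inverse transform sampling in each fibre: for almost every \<open>a\<close>, the levels
  \<open>u\<close> with quantile below \<open>t\<close> have measure equal to the supremum of
  \<open>cond_cdf \<nu> r a\<close> over rational \<open>r\<close> in \<open>{0..<t}\<close>. Fubini
  and monotone convergence then give the mass of \<open>B \<times> {..<t}\<close>.\<close>

lemma distr_cond_quantile:
  fixes \<nu> :: "('c::second_countable_topology \<times> real) measure"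
  assumes \<nu>: "prob_space \<nu>" and sets[measurable_cong]: "sets \<nu> = sets borel"
    and range: "AE p in \<nu>. snd p \<in> {0..1}"
  shows "distr (distr \<nu> borel fst \<Otimes>\<^sub>M unit_uniform) borel
     (\<lambda>p. (fst p, cond_quantile \<nu> (fst p) (snd p))) = \<nu>" (is "?L = _")
proof -
  interpret prob_space \<nu> by fact
  interpret U: prob_space unit_uniform by (rule prob_space_unit_uniform)
  let ?l = "distr \<nu> borel fst"
  interpret l: prob_space ?l
    by (rule prob_space_distr) simp
  interpret P: pair_prob_space ?l unit_uniform ..
  have fin: "finite_measure \<nu>" by unfold_locales
  have space: "space \<nu> = UNIV"
    using sets_eq_imp_space_eq[OF sets] by simp
  have setsP [measurable_cong]: "sets (?l \<Otimes>\<^sub>M unit_uniform) = sets borel"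
  proof -
    have "sets (?l \<Otimes>\<^sub>M unit_uniform) = sets (borel \<Otimes>\<^sub>M borel)"
      by (rule sets_pair_measure_cong) simp_all
    then show ?thesis unfolding borel_prod .
  qed
  have spaceP: "space (?l \<Otimes>\<^sub>M unit_uniform) = UNIV"
    using sets_eq_imp_space_eq[OF setsP] by simp
  have meas: "(\<lambda>p. (fst p, cond_quantile \<nu> (fst p) (snd p))) \<in> borel_measurable borel"
    by (intro borel_measurable_Pair) simp_all
  have meas' [measurable]:
    "(\<lambda>p. (fst p, cond_quantile \<nu> (fst p) (snd p))) \<in> borel_measurable (?l \<Otimes>\<^sub>M unit_uniform)"
    using meas by (simp add: measurable_cong_sets[OF setsP refl])
  \<comment> \<open>Each inequality has its own exceptional null set; restricting to rationals
    leaves countably many.\<close>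
  have AE_mono: "AE a in ?l. \<forall>r\<in>\<rat>. \<forall>r'\<in>\<rat>. r \<le> r' \<longrightarrow> cond_cdf \<nu> r a \<le> cond_cdf \<nu> r' a"
  proof (intro AE_ball_countable[THEN iffD2] countable_rat ballI)
    fix r r' :: real
    show "AE a in ?l. r \<le> r' \<longrightarrow> cond_cdf \<nu> r a \<le> cond_cdf \<nu> r' a"
    proof (cases "r \<le> r'")
      case True
      have "AE a in ?l. cond_cdf \<nu> r a \<le> cond_cdf \<nu> r' a"
        using True by (intro AE_cond_cdf_le fin sets refl emeasure_mono) (auto simp: sets intro!: borel_Times)
      then show ?thesis by eventually_elim simp
    qed simp
  qed
  have AE_le_1: "AE a in ?l. \<forall>r\<in>\<rat>. cond_cdf \<nu> r a \<le> 1"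
  proof (intro AE_ball_countable[THEN iffD2] countable_rat ballI)
    fix r :: real
    show "AE a in ?l. cond_cdf \<nu> r a \<le> 1"
    proof (rule AE_le_if_set_nn_integral_le)
      fix A assume "A \<in> sets ?l"
      then have A [measurable]: "A \<in> sets borel" by simp
      have "(\<integral>\<^sup>+a\<in>A. cond_cdf \<nu> r a \<partial>?l) = emeasure \<nu> (A \<times> {..<r})"
        by (intro set_nn_integral_cond_cdf fin sets A)
      also have "\<dots> \<le> emeasure \<nu> (fst -` A \<inter> space \<nu>)"
        by (intro emeasure_mono measurable_sets[of fst \<nu> borel]) (auto simp: space)
      also have "\<dots> = emeasure ?l A"
        by (intro emeasure_distr[symmetric]) auto
      finally show "(\<integral>\<^sup>+a\<in>A. cond_cdf \<nu> r a \<partial>?l) \<le> (\<integral>\<^sup>+a\<in>A. 1 \<partial>?l)" by simp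
    qed (simp_all add: l.emeasure_space_1)
  qed
  have "?L = \<nu>"
  proof (rule borel_measure_eqI_Times_lessThan)
    show "finite_measure ?L"
      by (intro P.finite_measure_distr) simp
    fix B :: "'c set" and t :: real
    assume B [measurable]: "B \<in> sets borel"
    let ?X = "{p. fst p \<in> B \<and> cond_quantile \<nu> (fst p) (snd p) < t}"
    have L: "emeasure ?L (B \<times> {..<t}) = emeasure (?l \<Otimes>\<^sub>M unit_uniform) ?X"
      by (subst emeasure_distr) (auto simp: spaceP intro!: borel_Times arg_cong2[where f = emeasure])
    \<comment> \<open>Second coordinates lie in the unit interval almost surely on both sides, so
      the condition \<open>< t\<close> is void for \<open>1 < t\<close> and impossible for
      \<open>t \<le> 0\<close>; only the middle case needs the distribution function.\<close>
    consider "1 < t" | "t \<le> 0" | "0 < t" "t \<le> 1" by linarith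
    then show "emeasure ?L (B \<times> {..<t}) = emeasure \<nu> (B \<times> {..<t})"
    proof cases
      case 1
      have "?X = B \<times> UNIV"
        using 1 cond_quantile_bounds(2)[of \<nu>] by (auto intro: le_less_trans)
      then have "emeasure ?L (B \<times> {..<t}) = emeasure ?l B * emeasure unit_uniform UNIV"
        unfolding L by (simp add: U.emeasure_pair_measure_Times)
      also have "\<dots> = emeasure ?l B"
        using U.emeasure_space_1 by simp
      also have "\<dots> = emeasure \<nu> (fst -` B \<inter> space \<nu>)"
        by (intro emeasure_distr) auto
      also have "\<dots> = emeasure \<nu> (B \<times> {..<t})"
      proof (rule emeasure_eq_AE)
        show "AE p in \<nu>. p \<in> fst -` B \<inter> space \<nu> \<longleftrightarrow> p \<in> B \<times> {..<t}"
          using range by eventually_elim (use 1 space in \<open>auto simp: mem_Times_iff\<close>)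
      qed (auto simp: sets intro!: borel_Times)
      finally show ?thesis .
    next
      case 2
      then have "?X = {}"
        using cond_quantile_bounds(1)[of \<nu>] by (auto simp: not_less intro: order_trans)
      moreover have "emeasure \<nu> (B \<times> {..<t}) = emeasure \<nu> {}"
      proof (rule emeasure_eq_AE)
        show "AE p in \<nu>. p \<in> B \<times> {..<t} \<longleftrightarrow> p \<in> {}"
          using range by eventually_elim (use 2 in \<open>auto simp: mem_Times_iff\<close>)
      qed (auto simp: sets intro!: borel_Times)
      ultimately show ?thesis unfolding L by (simp only: emeasure_empty)
    next
      case 3
      obtain q where q: "incseq q" "\<And>n. q n \<in> \<rat> \<inter> {0..<t}" "\<And>x. x < t \<Longrightarrow> \<exists>n. x < q n"
        using exists_rat_incseq[OF 3(1)] by blast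
      have "?X \<in> sets (?l \<Otimes>\<^sub>M unit_uniform)"
        unfolding setsP by measurable
      then have "emeasure ?L (B \<times> {..<t}) = (\<integral>\<^sup>+a. emeasure unit_uniform (Pair a -` ?X) \<partial>?l)"
        unfolding L by (rule U.emeasure_pair_measure_alt)
      also have "\<dots> = (\<integral>\<^sup>+a. (SUP n. cond_cdf \<nu> (q n) a * indicator B a) \<partial>?l)"
      proof (rule nn_integral_cong_AE)
        show "AE a in ?l. emeasure unit_uniform (Pair a -` ?X) = (SUP n. cond_cdf \<nu> (q n) a * indicator B a)"
          using AE_mono AE_le_1
        proof eventually_elim
          case (elim a)
          let ?S = "SUP r\<in>\<rat> \<inter> {0..<t}. cond_cdf \<nu> r a"
          have S: "?S = (SUP n. cond_cdf \<nu> (q n) a)"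
          proof (rule antisym)
            show "?S \<le> (SUP n. cond_cdf \<nu> (q n) a)"
            proof (rule SUP_least)
              fix r assume r: "r \<in> \<rat> \<inter> {0..<t}"
              then obtain n where "r < q n" using q(3)[of r] by auto
              then have "cond_cdf \<nu> r a \<le> cond_cdf \<nu> (q n) a"
                using elim(1) r q(2)[of n] by auto
              then show "cond_cdf \<nu> r a \<le> (SUP n. cond_cdf \<nu> (q n) a)"
                by (rule SUP_upper2[OF UNIV_I])
            qed
            show "(SUP n. cond_cdf \<nu> (q n) a) \<le> ?S"
              using q(2) by (intro SUP_mono) auto
          qed
          have "?S \<le> 1"
            using elim(2) by (intro SUP_least) auto
          show ?case
          proof (cases "a \<in> B")
            case True
            then have "Pair a -` ?X = {u. ennreal u < ?S}"
              by (auto simp: cond_quantile_less_iff[OF 3(2)])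
            then show ?thesis
              using emeasure_unit_uniform_less[OF \<open>?S \<le> 1\<close>] True S by simp
          qed simp
        qed
      qed
      also have "\<dots> = (SUP n. \<integral>\<^sup>+a\<in>B. cond_cdf \<nu> (q n) a \<partial>?l)"
      proof (rule nn_integral_monotone_convergence_SUP_AE)
        fix n
        show "AE a in ?l. cond_cdf \<nu> (q n) a * indicator B a \<le> cond_cdf \<nu> (q (Suc n)) a * indicator B a"
          using AE_mono
        proof eventually_elim
          case (elim a)
          then show ?case
            using incseq_SucD[OF q(1), of n] q(2)[of n] q(2)[of "Suc n"] by (intro mult_right_mono) auto
        qed
      qed simp
      also have "\<dots> = (SUP n. emeasure \<nu> (B \<times> {..<q n}))"
        by (simp add: set_nn_integral_cond_cdf[OF fin sets B])
      also have "\<dots> = emeasure \<nu> (\<Union>n. B \<times> {..<q n})"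
      proof (rule SUP_emeasure_incseq)
        show "range (\<lambda>n. B \<times> {..<q n}) \<subseteq> sets \<nu>"
          by (auto simp: sets intro!: borel_Times)
        show "incseq (\<lambda>n. B \<times> {..<q n})"
          using q(1) by (auto simp: incseq_def intro: less_le_trans)
      qed
      also have "(\<Union>n. B \<times> {..<q n}) = B \<times> {..<t}"
        using q(2,3) by (force intro: less_trans)
      finally show ?thesis .
    qed
  qed (simp_all add: sets)
  then show ?thesis .
qed

section \<open>Monotone couplings for leafwise total orders\<close>

text \<open>The interface between the geometry and the measure theory: \<open>S\<close> is a
  disjoint union of mutually incomparable leaves, each order-embedded by \<open>g\<close> in the
  unit interval, where the quantiles take their values.\<close>

locale leafwise_order =
  fixes le :: "'a::polish_space \<Rightarrow> 'a \<Rightarrow> bool" and S :: "'a set"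
    and \<Phi> :: "'a \<Rightarrow> 'c::polish_space" and g :: "'a \<Rightarrow> real"
  assumes S_borel: "S \<in> sets borel"
    and \<Phi>_borel [measurable]: "\<Phi> \<in> borel_measurable borel"
    and g_borel [measurable]: "g \<in> borel_measurable borel"
    and g_range: "g x \<in> {0..1}"
    and le_borel: "causal_rel le \<in> sets borel"
    and le_iff: "x \<in> S \<Longrightarrow> y \<in> S \<Longrightarrow> le x y \<longleftrightarrow> \<Phi> x = \<Phi> y \<and> g x \<le> g y"
    and leaf_gauge_inj: "x \<in> S \<Longrightarrow> y \<in> S \<Longrightarrow> \<Phi> x = \<Phi> y \<Longrightarrow> g x = g y \<Longrightarrow> x = y"
begin

definition coord :: "'a \<Rightarrow> 'c \<times> real" where
  "coord x = (\<Phi> x, g x)"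

lemma coord_borel [measurable]: "coord \<in> borel_measurable borel"
  unfolding coord_def by (intro borel_measurable_Pair \<Phi>_borel g_borel)

text \<open>Leaf and gauge together are injective on \<open>S\<close>. The compact pieces for both
  measures are pooled, so that a single \<open>h\<close> inverts the coordinates almost surely for
  each.\<close>

lemma exists_coord_inverse:
  assumes "borel_prob_on S \<mu>0" "borel_prob_on S \<mu>1"
  obtains h where "h \<in> borel_measurable borel"
    "AE x in \<mu>0. x \<in> S \<and> h (coord x) = x" "AE x in \<mu>1. x \<in> S \<and> h (coord x) = x"
proof -
  have fin: "finite_measure \<mu>0" "sets \<mu>0 = sets borel" "finite_measure \<mu>1" "sets \<mu>1 = sets borel"
    using assms prob_space.finite_measure by (auto simp: borel_prob_on_def)
  obtain \<K> where \<K>: "countable \<K>" "\<forall>K\<in>\<K>. compact K" "\<forall>K\<in>\<K>. continuous_on K coord"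
    "\<Union>\<K> \<subseteq> S" "AE x in \<mu>0. x \<in> S \<longrightarrow> x \<in> \<Union>\<K>"
    by (rule lusin_cover[OF fin(1,2) coord_borel S_borel])
  obtain \<L> where \<L>: "countable \<L>" "\<forall>K\<in>\<L>. compact K" "\<forall>K\<in>\<L>. continuous_on K coord"
    "\<Union>\<L> \<subseteq> S" "AE x in \<mu>1. x \<in> S \<longrightarrow> x \<in> \<Union>\<L>"
    by (rule lusin_cover[OF fin(3,4) coord_borel S_borel])
  have "inj_on coord S"
    using leaf_gauge_inj by (auto simp: inj_on_def coord_def)
  moreover have "\<Union>(\<K> \<union> \<L>) \<subseteq> S"
    using \<K>(4) \<L>(4) by auto
  ultimately have inj: "inj_on coord (\<Union>(\<K> \<union> \<L>))"
    by (rule inj_on_subset)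
  obtain h where h: "h \<in> borel_measurable borel" "\<forall>x\<in>\<Union>(\<K> \<union> \<L>). h (coord x) = x"
    by (rule borel_left_inverse[OF _ _ _ inj]) (use \<K>(1-3) \<L>(1-3) in auto)
  have S: "AE x in \<mu>0. x \<in> S" "AE x in \<mu>1. x \<in> S"
    using assms by (auto simp: borel_prob_on_def)
  show thesis
  proof (rule that[OF h(1)])
    show "AE x in \<mu>0. x \<in> S \<and> h (coord x) = x"
      using \<K>(5) S(1) by eventually_elim (use h(2) in auto)
    show "AE x in \<mu>1. x \<in> S \<and> h (coord x) = x"
      using \<L>(5) S(2) by eventually_elim (use h(2) in auto)
  qed
qed

lemma causal_coupling_facts:
  assumes \<mu>: "borel_prob_on S \<mu>0" "borel_prob_on S \<mu>1" and \<pi>: "\<pi> \<in> causal_couplings le \<mu>0 \<mu>1"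
  shows "prob_space \<pi>" "sets \<pi> = sets borel" "distr \<pi> borel fst = \<mu>0" "distr \<pi> borel snd = \<mu>1"
    "AE p in \<pi>. fst p \<in> S \<and> snd p \<in> S \<and> le (fst p) (snd p)"
proof -
  show "prob_space \<pi>" and sets: "sets \<pi> = sets borel"
    and d: "distr \<pi> borel fst = \<mu>0" "distr \<pi> borel snd = \<mu>1"
    using \<pi> by (auto simp: causal_couplings_def couplings_def)
  interpret prob_space \<pi> by fact
  note [measurable_cong] = sets
  have "AE p in \<pi>. p \<in> causal_rel le"
    using \<pi> le_borel sets by (subst AE_in_set_eq_1) (auto simp: causal_couplings_def emeasure_eq_measure)
  moreover have "AE p in \<pi>. fst p \<in> S"
    using \<mu>(1) S_borel unfolding borel_prob_on_def d[symmetric] by (subst (asm) AE_distr_iff) auto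
  moreover have "AE p in \<pi>. snd p \<in> S"
    using \<mu>(2) S_borel unfolding borel_prob_on_def d[symmetric] by (subst (asm) AE_distr_iff) auto
  ultimately show "AE p in \<pi>. fst p \<in> S \<and> snd p \<in> S \<and> le (fst p) (snd p)"
    by eventually_elim (auto simp: causal_rel_def)
qed

section \<open>Quadrant masses and uniqueness\<close>

text \<open>The masses of these sets form a joint distribution function of the gauges of the two
  points, fibred over the leaf they share almost surely under a causal coupling.\<close>

definition quadrant :: "'c set \<Rightarrow> real \<Rightarrow> real \<Rightarrow> ('a \<times> 'a) set" where
  "quadrant B s t = {p. \<Phi> (fst p) \<in> B \<and> g (fst p) < s \<and> g (snd p) < t}"

lemma quadrant_borel:
  assumes [measurable]: "B \<in> sets borel"
  shows "quadrant B s t \<in> sets borel"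
  unfolding quadrant_def by measurable

lemma emeasure_marginals:
  assumes "borel_prob_on S \<mu>0" "borel_prob_on S \<mu>1" "\<pi> \<in> causal_couplings le \<mu>0 \<mu>1"
    and [measurable]: "B \<in> sets borel"
  shows "emeasure \<mu>0 {x. \<Phi> x \<in> B \<and> g x < s} = emeasure \<pi> {p. \<Phi> (fst p) \<in> B \<and> g (fst p) < s}"
    and "emeasure \<mu>1 {y. \<Phi> y \<in> B \<and> g y < s} = emeasure \<pi> {p. \<Phi> (snd p) \<in> B \<and> g (snd p) < s}"
proof -
  note \<pi> = causal_coupling_facts[OF assms(1-3)]
  note [measurable_cong] = \<pi>(2)
  have space: "space \<pi> = UNIV"
    using sets_eq_imp_space_eq[OF \<pi>(2)] by simp
  show "emeasure \<mu>0 {x. \<Phi> x \<in> B \<and> g x < s} = emeasure \<pi> {p. \<Phi> (fst p) \<in> B \<and> g (fst p) < s}"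
    unfolding \<pi>(3)[symmetric] by (subst emeasure_distr) (auto simp: space vimage_def)
  show "emeasure \<mu>1 {y. \<Phi> y \<in> B \<and> g y < s} = emeasure \<pi> {p. \<Phi> (snd p) \<in> B \<and> g (snd p) < s}"
    unfolding \<pi>(4)[symmetric] by (subst emeasure_distr) (auto simp: space vimage_def)
qed

text \<open>On leaves in \<open>Z\<close> the condition on the first point is dropped, on the other
  leaves that on the second; what remains depends on the marginals alone.\<close>

lemma emeasure_quadrant_le:
  assumes \<mu>: "borel_prob_on S \<mu>0" "borel_prob_on S \<mu>1" "\<pi> \<in> causal_couplings le \<mu>0 \<mu>1"
    and B [measurable]: "B \<in> sets borel" and Z [measurable]: "Z \<in> sets borel"
  shows "emeasure \<pi> (quadrant B s t) \<le>
    emeasure \<mu>1 {y. \<Phi> y \<in> B \<inter> Z \<and> g y < t} + emeasure \<mu>0 {x. \<Phi> x \<in> B - Z \<and> g x < s}"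
proof -
  note \<pi> = causal_coupling_facts[OF \<mu>]
  note [measurable_cong] = \<pi>(2)
  let ?P = "{p. \<Phi> (snd p) \<in> B \<inter> Z \<and> g (snd p) < t}" and ?Q = "{p. \<Phi> (fst p) \<in> B - Z \<and> g (fst p) < s}"
  have meas: "?P \<in> sets \<pi>" "?Q \<in> sets \<pi>"
    unfolding \<pi>(2) by measurable
  have "emeasure \<pi> (quadrant B s t) \<le> emeasure \<pi> (?P \<union> ?Q)"
  proof (rule emeasure_mono_AE)
    show "AE p in \<pi>. p \<in> quadrant B s t \<longrightarrow> p \<in> ?P \<union> ?Q"
      using \<pi>(5) by eventually_elim (auto simp: quadrant_def le_iff)
  qed (use meas in auto)
  also have "\<dots> \<le> emeasure \<pi> ?P + emeasure \<pi> ?Q"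
    using meas by (rule emeasure_subadditive)
  finally show ?thesis
    unfolding emeasure_marginals(2)[OF \<mu> sets.Int[OF B Z]]
      emeasure_marginals(1)[OF \<mu> sets.Diff[OF B Z]] .
qed

text \<open>A monotone coupling attains the bound of the previous lemma: no leaf carries both a
  pair jumping up over \<open>(s, t)\<close> and a pair jumping down over it, so the leaves of the former kind
  serve as \<open>Z\<close>.\<close>

lemma emeasure_quadrant_eq:
  assumes \<mu>: "borel_prob_on S \<mu>0" "borel_prob_on S \<mu>1" "\<pi> \<in> causal_couplings le \<mu>0 \<mu>1"
    and mono: "concentrated_on_monotone le \<pi>"
  obtains Z where "Z \<in> sets borel"
    "\<forall>B\<in>sets borel. emeasure \<pi> (quadrant B s t) =
       emeasure \<mu>1 {y. \<Phi> y \<in> B \<inter> Z \<and> g y < t} + emeasure \<mu>0 {x. \<Phi> x \<in> B - Z \<and> g x < s}"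
proof -
  note \<pi> = causal_coupling_facts[OF \<mu>]
  note [measurable_cong] = \<pi>(2)
  interpret prob_space \<pi> by fact
  obtain A where A: "A \<in> sets borel" "monotone_set le A" "emeasure \<pi> A = 1"
    using mono by (auto simp: concentrated_on_monotone_def)
  have AE_A: "AE p in \<pi>. p \<in> A"
    using A \<pi>(2) by (subst AE_in_set_eq_1) (auto simp: emeasure_eq_measure)
  define C where "C = A \<inter> (S \<times> S) \<inter> causal_rel le"
  have [measurable]: "C \<in> sets borel"
    unfolding C_def using A(1) S_borel le_borel by (intro sets.Int borel_Times)
  define E where "E = C \<inter> {p. g (fst p) < s \<and> t \<le> g (snd p)}"
  have E: "E \<in> sets borel"
    unfolding E_def by measurable
  have f: "(\<lambda>p. \<Phi> (fst p)) \<in> borel_measurable (borel :: ('a \<times> 'a) measure)" by measurable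
  \<comment> \<open>The projection of the upward pairs \<open>E\<close> to the leaves need not be
    Borel, so \<open>Z\<close> is the projection of compact pieces covering almost all of
    \<open>E\<close>. Hence \<open>up\<close> holds almost surely, while \<open>down\<close> holds
    at every point of \<open>C\<close>.\<close>
  obtain \<K> where \<K>: "countable \<K>" "\<forall>K\<in>\<K>. compact K"
    "\<forall>K\<in>\<K>. continuous_on K (\<lambda>p. \<Phi> (fst p))" "\<Union>\<K> \<subseteq> E" "AE p in \<pi>. p \<in> E \<longrightarrow> p \<in> \<Union>\<K>"
    by (rule lusin_cover[OF finite_measure_axioms \<pi>(2) f E])
  define Z where "Z = (\<Union>K\<in>\<K>. (\<lambda>p. \<Phi> (fst p)) ` K)"
  have Z [measurable]: "Z \<in> sets borel"
    unfolding Z_def using \<K>(1-3)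
    by (intro sets.countable_UN') (auto intro!: borel_compact compact_continuous_image)
  have AE_C: "AE p in \<pi>. p \<in> C"
    using AE_A \<pi>(5) by eventually_elim (auto simp: C_def causal_rel_def mem_Times_iff)
  have up: "AE p in \<pi>. \<Phi> (fst p) \<notin> Z \<longrightarrow> g (fst p) < s \<longrightarrow> g (snd p) < t"
    using AE_C \<K>(5)
  proof eventually_elim
    case (elim p)
    show ?case
    proof (intro impI, rule ccontr)
      assume "\<Phi> (fst p) \<notin> Z" "g (fst p) < s" "\<not> g (snd p) < t"
      then have "p \<in> E"
        using elim(1) by (simp add: E_def)
      then obtain K where "K \<in> \<K>" "p \<in> K"
        using elim(2) by blast
      then show False
        using \<open>\<Phi> (fst p) \<notin> Z\<close> unfolding Z_def by blast
    qed
  qed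
  \<comment> \<open>Otherwise an upward pair \<open>p'\<close> on the same leaf would start strictly
    before \<open>p\<close> and yet end strictly after it, against monotonicity of
    \<open>A\<close>.\<close>
  have down: "g (fst p) < s" if p: "p \<in> C" "\<Phi> (fst p) \<in> Z" "g (snd p) < t" for p
  proof (rule ccontr)
    assume "\<not> g (fst p) < s"
    obtain p' where p': "p' \<in> E" "\<Phi> (fst p) = \<Phi> (fst p')"
      using p(2) \<K>(4) unfolding Z_def by blast
    have S: "fst p \<in> S" "fst p' \<in> S" "snd p \<in> S" "snd p' \<in> S" and pA: "p \<in> A" "p' \<in> A"
      using p(1) p'(1) by (auto simp: E_def C_def)
    have less: "g (fst p') < g (fst p)"
      using p'(1) \<open>\<not> g (fst p) < s\<close> by (auto simp: E_def)
    then have "le (fst p') (fst p)" "fst p' \<noteq> fst p"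
      using le_iff[OF S(2,1)] p'(2) by auto
    then have "le (snd p') (snd p)"
      using A(2) pA by (auto simp: monotone_set_def split_beta)
    then have "g (snd p') \<le> g (snd p)"
      using le_iff[OF S(4,3)] by simp
    then show False
      using p'(1) p(3) by (auto simp: E_def)
  qed
  show thesis
  proof (rule that[OF Z], intro ballI)
    fix B :: "'c set" assume B [measurable]: "B \<in> sets borel"
    let ?P = "{p. \<Phi> (snd p) \<in> B \<inter> Z \<and> g (snd p) < t}" and ?Q = "{p. \<Phi> (fst p) \<in> B - Z \<and> g (fst p) < s}"
    have leaf: "AE p in \<pi>. \<Phi> (fst p) = \<Phi> (snd p)"
      using \<pi>(5) by eventually_elim (auto simp: le_iff)
    have meas: "?P \<in> sets \<pi>" "?Q \<in> sets \<pi>"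
      unfolding \<pi>(2) by measurable
    \<comment> \<open>One set lies over \<open>Z\<close> through the second point, the other over
      its complement through the first; they are disjoint up to a null set because the leaves agree
      almost surely.\<close>
    have "emeasure \<pi> ?P + emeasure \<pi> ?Q = emeasure \<pi> (?P \<union> (?Q - ?P))"
    proof (subst plus_emeasure[symmetric])
      have "emeasure \<pi> ?Q = emeasure \<pi> (?Q - ?P)"
      proof (rule emeasure_eq_AE)
        show "AE p in \<pi>. p \<in> ?Q \<longleftrightarrow> p \<in> ?Q - ?P"
          using leaf by eventually_elim auto
      qed (use meas in auto)
      then show "emeasure \<pi> ?P + emeasure \<pi> ?Q = emeasure \<pi> ?P + emeasure \<pi> (?Q - ?P)" by simp
    qed (use meas in auto)
    also have "\<dots> = emeasure \<pi> (quadrant B s t)"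
    proof (rule emeasure_eq_AE)
      show "AE p in \<pi>. p \<in> ?P \<union> (?Q - ?P) \<longleftrightarrow> p \<in> quadrant B s t"
        using leaf up AE_C by eventually_elim (use down in \<open>auto simp: quadrant_def\<close>)
    qed (use meas quadrant_borel[OF B] \<pi>(2) in auto)
    finally show "emeasure \<pi> (quadrant B s t) =
        emeasure \<mu>1 {y. \<Phi> y \<in> B \<inter> Z \<and> g y < t} + emeasure \<mu>0 {x. \<Phi> x \<in> B - Z \<and> g x < s}"
      unfolding emeasure_marginals(2)[OF \<mu> sets.Int[OF B Z]]
        emeasure_marginals(1)[OF \<mu> sets.Diff[OF B Z]] by (rule sym)
  qed
qed

text \<open>The \<open>Z\<close> that gives equality for the monotone coupling gives an upper bound
  for every other causal coupling. Two monotone couplings thus bound each other.\<close>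

lemma emeasure_quadrant_maximal:
  assumes \<mu>: "borel_prob_on S \<mu>0" "borel_prob_on S \<mu>1"
    and \<pi>: "\<pi> \<in> causal_couplings le \<mu>0 \<mu>1" "concentrated_on_monotone le \<pi>"
    and \<pi>': "\<pi>' \<in> causal_couplings le \<mu>0 \<mu>1"
    and B: "B \<in> sets borel"
  shows "emeasure \<pi>' (quadrant B s t) \<le> emeasure \<pi> (quadrant B s t)"
proof -
  obtain Z where Z: "Z \<in> sets borel" "\<forall>B\<in>sets borel. emeasure \<pi> (quadrant B s t) =
      emeasure \<mu>1 {y. \<Phi> y \<in> B \<inter> Z \<and> g y < t} + emeasure \<mu>0 {x. \<Phi> x \<in> B - Z \<and> g x < s}"
    by (rule emeasure_quadrant_eq[OF \<mu> \<pi>])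
  show ?thesis
    unfolding Z(2)[THEN bspec, OF B] by (rule emeasure_quadrant_le[OF \<mu> \<pi>' B Z(1)])
qed

text \<open>The leaf of the second point is left out since a causal coupling gives it almost surely
  the leaf of the first.\<close>

definition pair_coord :: "'a \<times> 'a \<Rightarrow> ('c \<times> real) \<times> real" where
  "pair_coord p = (coord (fst p), g (snd p))"

lemma pair_coord_borel [measurable]: "pair_coord \<in> borel_measurable borel"
  unfolding pair_coord_def by (intro borel_measurable_Pair) measurable

text \<open>The generator criterion is applied twice. For fixed \<open>t\<close>, the restricted
  laws \<open>V t\<close> are compared on products \<open>B \<times> {..<s}\<close>, which are
  quadrants; the resulting equality for all Borel \<open>D\<close> is then used with varying
  \<open>t\<close>.\<close>

lemma distr_pair_coord_eqI:
  assumes \<pi>: "prob_space \<pi>" "sets \<pi> = sets borel" and \<pi>': "prob_space \<pi>'" "sets \<pi>' = sets borel"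
    and eq: "\<And>B s t. B \<in> sets borel \<Longrightarrow> emeasure \<pi> (quadrant B s t) = emeasure \<pi>' (quadrant B s t)"
  shows "distr \<pi> borel pair_coord = distr \<pi>' borel pair_coord"
proof (rule borel_measure_eqI_Times_lessThan)
  define V where "V t \<rho> = distr (density \<rho> (indicator {p. g (snd p) < t})) borel (\<lambda>p. coord (fst p))"
    for t and \<rho> :: "('a \<times> 'a) measure"
  have V: "emeasure (V t \<rho>) D = emeasure \<rho> {p. coord (fst p) \<in> D \<and> g (snd p) < t}"
    if "sets \<rho> = sets borel" "D \<in> sets borel" for t D \<rho>
  proof -
    note [measurable_cong] = that(1) and [measurable] = that(2)
    have space: "space \<rho> = UNIV"
      using sets_eq_imp_space_eq[OF that(1)] by simp
    have "emeasure (V t \<rho>) D = emeasure (density \<rho> (indicator {p. g (snd p) < t})) {p. coord (fst p) \<in> D}"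
      unfolding V_def by (subst emeasure_distr) (auto simp: space vimage_def)
    also have "\<dots> = emeasure \<rho> ({p. g (snd p) < t} \<inter> {p. coord (fst p) \<in> D})"
      unfolding that(1)[symmetric]
      by (rule emeasure_restricted) (simp_all add: that(1))
    also have "{p. g (snd p) < t} \<inter> {p. coord (fst p) \<in> D} = {p. coord (fst p) \<in> D \<and> g (snd p) < t}"
      by auto
    finally show ?thesis .
  qed
  show "finite_measure (distr \<pi> borel pair_coord)"
    using \<pi> by (intro prob_space.finite_measure prob_space.prob_space_distr) (auto simp: measurable_cong_sets[OF \<pi>(2) refl])
  fix D :: "('c \<times> real) set" and t :: real
  assume D [measurable]: "D \<in> sets borel"
  have "V t \<pi> = V t \<pi>'"
  proof (rule borel_measure_eqI_Times_lessThan)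
    show "finite_measure (V t \<pi>)"
    proof
      have U: "UNIV \<in> sets (borel :: ('c \<times> real) measure)" by simp
      have "emeasure (V t \<pi>) UNIV \<le> emeasure \<pi> (space \<pi>)"
        unfolding V[OF \<pi>(2) U] by (rule emeasure_space)
      then show "emeasure (V t \<pi>) (space (V t \<pi>)) \<noteq> \<infinity>"
        using prob_space.emeasure_space_1[OF \<pi>(1)] by (auto simp: V_def top_unique)
    qed
    fix B :: "'c set" and s :: real assume B: "B \<in> sets borel"
    have BD: "B \<times> {..<s} \<in> sets borel"
      using B by (intro borel_Times) auto
    have "{p. coord (fst p) \<in> B \<times> {..<s} \<and> g (snd p) < t} = quadrant B s t"
      by (auto simp: quadrant_def coord_def)
    then show "emeasure (V t \<pi>) (B \<times> {..<s}) = emeasure (V t \<pi>') (B \<times> {..<s})"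
      using eq[OF B] V[OF \<pi>(2) BD] V[OF \<pi>'(2) BD] by simp
  qed (simp_all add: V_def)
  then have *: "emeasure \<pi> {p. coord (fst p) \<in> D \<and> g (snd p) < t} =
      emeasure \<pi>' {p. coord (fst p) \<in> D \<and> g (snd p) < t}"
    using V[OF \<pi>(2) D, of t] V[OF \<pi>'(2) D, of t] by simp
  have pre: "pair_coord -` (D \<times> {..<t}) \<inter> space \<rho> = {p. coord (fst p) \<in> D \<and> g (snd p) < t}"
    if "sets \<rho> = sets borel" for \<rho>
    using sets_eq_imp_space_eq[OF that] by (auto simp: pair_coord_def)
  have "emeasure (distr \<rho> borel pair_coord) (D \<times> {..<t}) =
      emeasure \<rho> {p. coord (fst p) \<in> D \<and> g (snd p) < t}" if "sets \<rho> = sets borel" for \<rho>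
    unfolding pre[OF that, symmetric] using that
    by (intro emeasure_distr borel_Times D) (auto simp: measurable_cong_sets[OF that refl])
  then show "emeasure (distr \<pi> borel pair_coord) (D \<times> {..<t}) =
      emeasure (distr \<pi>' borel pair_coord) (D \<times> {..<t})"
    using * \<pi>(2) \<pi>'(2) by simp
qed simp_all

theorem monotone_coupling_unique:
  assumes \<mu>: "borel_prob_on S \<mu>0" "borel_prob_on S \<mu>1"
    and \<pi>: "\<pi> \<in> causal_couplings le \<mu>0 \<mu>1" "concentrated_on_monotone le \<pi>"
    and \<pi>': "\<pi>' \<in> causal_couplings le \<mu>0 \<mu>1" "concentrated_on_monotone le \<pi>'"
  shows "\<pi> = \<pi>'"
proof -
  obtain h where h [measurable]: "h \<in> borel_measurable borel"
    and inv: "AE x in \<mu>0. x \<in> S \<and> h (coord x) = x" "AE x in \<mu>1. x \<in> S \<and> h (coord x) = x"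
    by (rule exists_coord_inverse[OF \<mu>])
  \<comment> \<open>The second point is recovered from the leaf of the first together with its own
    gauge value.\<close>
  define J where "J q = (h (fst q), h (fst (fst q), snd q))" for q :: "('c \<times> real) \<times> real"
  have J [measurable]: "J \<in> borel_measurable borel"
    unfolding J_def
    by (intro borel_measurable_Pair measurable_compose[OF _ h]) measurable
  have recover: "distr (distr \<rho> borel pair_coord) borel J = \<rho>" if \<rho>: "\<rho> \<in> causal_couplings le \<mu>0 \<mu>1" for \<rho>
  proof -
    note c = causal_coupling_facts[OF \<mu> \<rho>]
    note [measurable_cong] = c(2)
    have "AE p in \<rho>. h (coord (fst p)) = fst p"
      using AE_distrD[of fst \<rho> borel] inv(1) unfolding c(3)[symmetric] by fastforce
    moreover have "AE p in \<rho>. h (coord (snd p)) = snd p"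
      using AE_distrD[of snd \<rho> borel] inv(2) unfolding c(4)[symmetric] by fastforce
    ultimately have "AE p in \<rho>. J (pair_coord p) = p"
      using c(5)
    proof eventually_elim
      case (elim p)
      then have "\<Phi> (fst p) = \<Phi> (snd p)" using le_iff by blast
      with elim show ?case
        by (simp add: J_def pair_coord_def coord_def)
    qed
    have "distr (distr \<rho> borel pair_coord) borel J = distr \<rho> borel (J \<circ> pair_coord)"
      by (rule distr_distr) measurable
    also have "\<dots> = distr \<rho> borel (\<lambda>p. p)"
      using \<open>AE p in \<rho>. J (pair_coord p) = p\<close>
      by (intro distr_cong_AE) (auto simp: measurable_cong_sets[OF c(2) refl])
    also have "\<dots> = \<rho>"
      using c(2) by (intro distr_id2) simp
    finally show ?thesis .
  qed
  have "distr \<pi> borel pair_coord = distr \<pi>' borel pair_coord"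
  proof (rule distr_pair_coord_eqI)
    show "emeasure \<pi> (quadrant B s t) = emeasure \<pi>' (quadrant B s t)" if "B \<in> sets borel" for B s t
      by (intro antisym emeasure_quadrant_maximal[OF \<mu> \<pi> \<pi>'(1) that]
          emeasure_quadrant_maximal[OF \<mu> \<pi>' \<pi>(1) that])
  qed (use causal_coupling_facts[OF \<mu> \<pi>(1)] causal_coupling_facts[OF \<mu> \<pi>'(1)] in auto)
  then have "distr (distr \<pi> borel pair_coord) borel J = distr (distr \<pi>' borel pair_coord) borel J"
    by (rule arg_cong)
  then show ?thesis
    unfolding recover[OF \<pi>(1)] recover[OF \<pi>'(1)] .
qed

section \<open>Existence by leafwise quantile coupling\<close>

theorem monotone_coupling_exists:
  assumes \<mu>: "borel_prob_on S \<mu>0" "borel_prob_on S \<mu>1" and ne: "causal_couplings le \<mu>0 \<mu>1 \<noteq> {}"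
  shows "\<exists>\<pi>\<in>causal_couplings le \<mu>0 \<mu>1. concentrated_on_monotone le \<pi>"
proof -
  obtain \<pi>0 where \<pi>0: "\<pi>0 \<in> causal_couplings le \<mu>0 \<mu>1" using ne by blast
  note c = causal_coupling_facts[OF \<mu> \<pi>0]
  note [measurable_cong] = c(2)
  have p\<mu>: "prob_space \<mu>0" "prob_space \<mu>1" and s\<mu>: "sets \<mu>0 = sets borel" "sets \<mu>1 = sets borel"
    using \<mu> by (auto simp: borel_prob_on_def)
  note [measurable_cong] = s\<mu>
  obtain h where h [measurable]: "h \<in> borel_measurable borel"
    and inv: "AE x in \<mu>0. x \<in> S \<and> h (coord x) = x" "AE x in \<mu>1. x \<in> S \<and> h (coord x) = x"
    by (rule exists_coord_inverse[OF \<mu>])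
  define \<nu>0 \<nu>1 where "\<nu>0 = distr \<mu>0 borel coord" and "\<nu>1 = distr \<mu>1 borel coord"
  note \<nu>_def = \<nu>0_def \<nu>1_def
  have s\<nu>: "sets \<nu>0 = sets borel" "sets \<nu>1 = sets borel"
    by (simp_all add: \<nu>_def)
  note [measurable_cong] = s\<nu>
  have p\<nu>: "prob_space \<nu>0" "prob_space \<nu>1"
    unfolding \<nu>_def by (intro prob_space.prob_space_distr p\<mu>; measurable)+
  have f\<nu>: "finite_measure \<nu>0" "finite_measure \<nu>1"
    using p\<nu> by (auto intro: prob_space.finite_measure)
  have r\<nu>: "AE q in \<nu>0. snd q \<in> {0..1}" "AE q in \<nu>1. snd q \<in> {0..1}"
    unfolding \<nu>_def using g_range by (auto simp: AE_distr_iff coord_def)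
  define l where "l = distr \<nu>0 borel fst"
  \<comment> \<open>Under the given causal coupling both points lie on the same leaf almost surely,
    so the two measures have the same law of leaves.\<close>
  have l1: "l = distr \<nu>1 borel fst"
  proof -
    have "l = distr \<mu>0 borel \<Phi>"
      unfolding l_def \<nu>0_def by (subst distr_distr) (auto simp: coord_def comp_def)
    also have "\<dots> = distr \<pi>0 borel (\<lambda>p. \<Phi> (fst p))"
      unfolding c(3)[symmetric] by (subst distr_distr) (auto simp: comp_def)
    also have "\<dots> = distr \<pi>0 borel (\<lambda>p. \<Phi> (snd p))"
    proof (rule distr_cong_AE)
      show "AE p in \<pi>0. \<Phi> (fst p) = \<Phi> (snd p)"
        using c(5) by eventually_elim (auto simp: le_iff)
    qed measurable
    also have "\<dots> = distr \<mu>1 borel \<Phi>"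
      unfolding c(4)[symmetric] by (subst distr_distr) (auto simp: comp_def)
    also have "\<dots> = distr \<nu>1 borel fst"
      unfolding \<nu>1_def by (subst distr_distr) (auto simp: coord_def comp_def)
    finally show ?thesis .
  qed
  have l_sets: "sets l = sets borel" by (simp add: l_def)
  \<comment> \<open>A point of \<open>\<Omega>\<close> is a leaf with a level \<open>u\<close>. Both
    quantile functions are evaluated at the same level, which is what makes the coupling
    monotone.\<close>
  define \<Omega> where "\<Omega> = l \<Otimes>\<^sub>M unit_uniform"
  define Q0 Q1 where "Q0 p = cond_quantile \<nu>0 (fst p) (snd p)"
    and "Q1 p = cond_quantile \<nu>1 (fst p) (snd p)" for p
  have Q [measurable]: "Q0 \<in> borel_measurable borel" "Q1 \<in> borel_measurable borel"
    unfolding Q0_def Q1_def by measurable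
  have s\<Omega>: "sets \<Omega> = sets borel"
  proof -
    have "sets \<Omega> = sets (borel \<Otimes>\<^sub>M borel)"
      unfolding \<Omega>_def by (rule sets_pair_measure_cong) (simp_all add: l_sets)
    then show ?thesis unfolding borel_prod .
  qed
  note [measurable_cong] = s\<Omega>
  interpret U: prob_space unit_uniform by (rule prob_space_unit_uniform)
  interpret l: prob_space l
    unfolding l_def by (intro prob_space.prob_space_distr p\<nu>) measurable
  interpret P: pair_prob_space l unit_uniform ..
  interpret \<Omega>: prob_space \<Omega>
    unfolding \<Omega>_def by (rule P.prob_space_axioms)
  have Qm0 [measurable]: "(\<lambda>p. (fst p, Q0 p)) \<in> borel_measurable borel"
    and Qm1 [measurable]: "(\<lambda>p. (fst p, Q1 p)) \<in> borel_measurable borel"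
    by (intro borel_measurable_Pair Q borel_measurable_fst_borel)+
  have Qm0' [measurable]: "(\<lambda>p. (fst p, Q0 p)) \<in> borel_measurable \<Omega>"
    and Qm1' [measurable]: "(\<lambda>p. (fst p, Q1 p)) \<in> borel_measurable \<Omega>"
    using Qm0 Qm1 by (simp_all add: measurable_cong_sets[OF s\<Omega> refl])
  have law0: "distr \<Omega> borel (\<lambda>p. (fst p, Q0 p)) = \<nu>0"
    unfolding \<Omega>_def l_def Q0_def by (intro distr_cond_quantile p\<nu> s\<nu> r\<nu>)
  have law1: "distr \<Omega> borel (\<lambda>p. (fst p, Q1 p)) = \<nu>1"
    unfolding \<Omega>_def l1 Q1_def by (intro distr_cond_quantile p\<nu> s\<nu> r\<nu>)

  have AE_Q: "AE p in \<Omega>. Q0 p \<le> Q1 p"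
  proof -
    \<comment> \<open>The gauge does not decrease along the given coupling, so within each set of
      leaves \<open>\<nu>1\<close> gives lower gauge values at most the mass that
      \<open>\<nu>0\<close> does. A smaller distribution function has larger quantiles.\<close>
    have dom: "emeasure \<nu>1 (B \<times> {..<r}) \<le> emeasure \<nu>0 (B \<times> {..<r})"
      if B [measurable]: "B \<in> sets borel" for B r
    proof -
      have space: "space \<mu>0 = UNIV" "space \<mu>1 = UNIV"
        using sets_eq_imp_space_eq[OF s\<mu>(1)] sets_eq_imp_space_eq[OF s\<mu>(2)] by auto
      have "emeasure \<nu>1 (B \<times> {..<r}) = emeasure \<mu>1 {y. \<Phi> y \<in> B \<and> g y < r}"
        unfolding \<nu>1_def by (subst emeasure_distr) (auto simp: space coord_def vimage_def intro!: borel_Times)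
      also have "\<dots> = emeasure \<pi>0 {p. \<Phi> (snd p) \<in> B \<and> g (snd p) < r}"
        by (rule emeasure_marginals[OF \<mu> \<pi>0 B])
      also have "\<dots> \<le> emeasure \<pi>0 {p. \<Phi> (fst p) \<in> B \<and> g (fst p) < r}"
      proof (rule emeasure_mono_AE)
        show "AE p in \<pi>0. p \<in> {p. \<Phi> (snd p) \<in> B \<and> g (snd p) < r} \<longrightarrow>
            p \<in> {p. \<Phi> (fst p) \<in> B \<and> g (fst p) < r}"
          using c(5) by eventually_elim (auto simp: le_iff)
      qed (unfold c(2), measurable)
      also have "\<dots> = emeasure \<mu>0 {x. \<Phi> x \<in> B \<and> g x < r}"
        by (rule emeasure_marginals[OF \<mu> \<pi>0 B, symmetric])
      also have "\<dots> = emeasure \<nu>0 (B \<times> {..<r})"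
        unfolding \<nu>0_def by (subst emeasure_distr) (auto simp: space coord_def vimage_def intro!: borel_Times)
      finally show ?thesis .
    qed
    have "AE a in l. \<forall>r\<in>\<rat>. cond_cdf \<nu>1 r a \<le> cond_cdf \<nu>0 r a"
    proof (intro AE_ball_countable[THEN iffD2] countable_rat ballI)
      show "AE a in l. cond_cdf \<nu>1 r a \<le> cond_cdf \<nu>0 r a" for r
        unfolding l_def by (intro AE_cond_cdf_le f\<nu> s\<nu> dom) (simp_all add: l1[symmetric] l_def[symmetric])
    qed
    then have "AE a in distr \<Omega> l fst. \<forall>r\<in>\<rat>. cond_cdf \<nu>1 r a \<le> cond_cdf \<nu>0 r a"
      unfolding \<Omega>_def U.distr_pair_fst .
    then have "AE p in \<Omega>. \<forall>r\<in>\<rat>. cond_cdf \<nu>1 r (fst p) \<le> cond_cdf \<nu>0 r (fst p)"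
      by (rule AE_distrD[rotated]) (simp add: \<Omega>_def)
    then show ?thesis
    proof eventually_elim
      case (elim p)
      show ?case
        unfolding Q0_def Q1_def
        using elim by (intro cond_quantile_mono_measure) (auto intro: less_le_trans)
    qed
  qed
  \<comment> \<open>Not every pair is the coordinate of a point of \<open>S\<close>. Since the
    quantile maps have laws \<open>\<nu>0\<close> and \<open>\<nu>1\<close>, their values are almost
    surely coordinates on which \<open>h\<close> is a genuine inverse.\<close>
  define good where "good q \<longleftrightarrow> h q \<in> S \<and> coord (h q) = q" for q
  have good [measurable]: "{q. good q} \<in> sets borel"
  proof -
    have "{q \<in> space borel. coord (h q) = q} \<in> sets borel"
      by (rule measurable_equality_set) measurable
    moreover have "h -` S \<in> sets borel"
      using measurable_sets_borel[OF h S_borel] .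
    moreover have "{q. good q} = h -` S \<inter> {q \<in> space borel. coord (h q) = q}"
      by (auto simp: good_def)
    ultimately show ?thesis by auto
  qed
  have "AE q in \<nu>0. good q" "AE q in \<nu>1. good q"
  proof -
    have "AE x in \<mu>0. good (coord x)" "AE x in \<mu>1. good (coord x)"
      using inv by (auto simp: good_def simp del: AE_conj_iff elim!: eventually_mono)
    then show "AE q in \<nu>0. good q" "AE q in \<nu>1. good q"
      unfolding \<nu>_def by (subst AE_distr_iff; simp add: good)+
  qed
  then have AE_good: "AE p in \<Omega>. good (fst p, Q0 p)" "AE p in \<Omega>. good (fst p, Q1 p)"
    unfolding law0[symmetric] law1[symmetric]
    using AE_distrD[OF Qm0', of good] AE_distrD[OF Qm1', of good] by blast+
  \<comment> \<open>Monotonicity of a set is a pointwise condition, so the almost-sure properties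
    are collected into a set on which they hold everywhere.\<close>
  define \<Omega>0 where "\<Omega>0 = {p. good (fst p, Q0 p) \<and> good (fst p, Q1 p) \<and> Q0 p \<le> Q1 p}"
  have AE_\<Omega>0: "AE p in \<Omega>. p \<in> \<Omega>0"
    using AE_Q AE_good by eventually_elim (auto simp: \<Omega>0_def)
  have \<Omega>0 [measurable]: "\<Omega>0 \<in> sets borel"
  proof -
    have "\<Omega>0 = (\<lambda>p. (fst p, Q0 p)) -` {q. good q} \<inter> (\<lambda>p. (fst p, Q1 p)) -` {q. good q} \<inter> {p. Q0 p \<le> Q1 p}"
      by (auto simp: \<Omega>0_def)
    moreover have "{p. Q0 p \<le> Q1 p} \<in> sets borel"
      by measurable
    ultimately show ?thesis
      using measurable_sets_borel[OF Qm0 good] measurable_sets_borel[OF Qm1 good] by simp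
  qed
  define V where "V p = (h (fst p, Q0 p), h (fst p, Q1 p))" for p
  have hQ: "(\<lambda>p. h (fst p, Q0 p)) \<in> borel_measurable borel" "(\<lambda>p. h (fst p, Q1 p)) \<in> borel_measurable borel"
    using measurable_compose[OF Qm0 h] measurable_compose[OF Qm1 h] by simp_all
  have V: "V \<in> borel_measurable borel"
    unfolding V_def by (intro borel_measurable_Pair hQ)
  then have V\<Omega> [measurable]: "V \<in> borel_measurable \<Omega>"
    by (simp add: measurable_cong_sets[OF s\<Omega> refl])
  have V_S: "h (fst p, Q0 p) \<in> S" "h (fst p, Q1 p) \<in> S"
    "\<Phi> (h (fst p, Q0 p)) = fst p" "\<Phi> (h (fst p, Q1 p)) = fst p"
    "g (h (fst p, Q0 p)) = Q0 p" "g (h (fst p, Q1 p)) = Q1 p" if "p \<in> \<Omega>0" for p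
    using that by (auto simp: \<Omega>0_def good_def coord_def)
  define \<pi> where "\<pi> = distr \<Omega> borel V"
  interpret \<pi>: prob_space \<pi>
    unfolding \<pi>_def by (rule \<Omega>.prob_space_distr) measurable
  have s\<pi>: "sets \<pi> = sets borel" by (simp add: \<pi>_def)
  have full: "emeasure \<pi> A = 1" if A: "A \<in> sets borel" and AE: "AE p in \<Omega>. V p \<in> A" for A
  proof (rule \<pi>.emeasure_eq_1_AE)
    show "A \<in> sets \<pi>" using A s\<pi> by simp
    show "AE q in \<pi>. q \<in> A"
      unfolding \<pi>_def using A AE by (subst AE_distr_iff) auto
  qed
  have "distr \<pi> borel fst = \<mu>0"
  proof -
    have "distr \<pi> borel fst = distr \<Omega> borel (\<lambda>p. h (fst p, Q0 p))"
      unfolding \<pi>_def by (subst distr_distr) (auto simp: V_def comp_def)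
    also have "\<dots> = distr \<nu>0 borel h"
      unfolding law0[symmetric] by (subst distr_distr) (auto simp: comp_def)
    also have "\<dots> = distr \<mu>0 borel (\<lambda>x. h (coord x))"
      unfolding \<nu>0_def by (subst distr_distr) (auto simp: comp_def)
    also have "\<dots> = distr \<mu>0 borel (\<lambda>x. x)"
      using inv(1) by (intro distr_cong_AE) auto
    also have "\<dots> = \<mu>0"
      by (intro distr_id2 s\<mu>(1)[symmetric])
    finally show ?thesis .
  qed
  moreover have "distr \<pi> borel snd = \<mu>1"
  proof -
    have "distr \<pi> borel snd = distr \<Omega> borel (\<lambda>p. h (fst p, Q1 p))"
      unfolding \<pi>_def by (subst distr_distr) (auto simp: V_def comp_def)
    also have "\<dots> = distr \<nu>1 borel h"
      unfolding law1[symmetric] by (subst distr_distr) (auto simp: comp_def)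
    also have "\<dots> = distr \<mu>1 borel (\<lambda>x. h (coord x))"
      unfolding \<nu>1_def by (subst distr_distr) (auto simp: comp_def)
    also have "\<dots> = distr \<mu>1 borel (\<lambda>x. x)"
      using inv(2) by (intro distr_cong_AE) auto
    also have "\<dots> = \<mu>1"
      by (intro distr_id2 s\<mu>(2)[symmetric])
    finally show ?thesis .
  qed
  moreover have "emeasure \<pi> (causal_rel le) = 1"
  proof (rule full[OF le_borel])
    show "AE p in \<Omega>. V p \<in> causal_rel le"
      using AE_\<Omega>0
    proof eventually_elim
      case (elim p)
      then have "Q0 p \<le> Q1 p" by (simp add: \<Omega>0_def)
      then show ?case
        using V_S[OF elim] by (simp add: V_def causal_rel_def le_iff)
    qed
  qed
  ultimately have "\<pi> \<in> causal_couplings le \<mu>0 \<mu>1"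
    using s\<pi> \<pi>.prob_space_axioms by (simp add: causal_couplings_def couplings_def)
  moreover have "concentrated_on_monotone le \<pi>"
  proof -
    \<comment> \<open>The image of \<open>\<Omega>0\<close> under \<open>V\<close> need not be
      Borel; the image of compact pieces is, and it still carries full mass.\<close>
    obtain \<K> where \<K>: "countable \<K>" "\<forall>K\<in>\<K>. compact K" "\<forall>K\<in>\<K>. continuous_on K V"
      "\<Union>\<K> \<subseteq> \<Omega>0" "AE p in \<Omega>. p \<in> \<Omega>0 \<longrightarrow> p \<in> \<Union>\<K>"
      by (rule lusin_cover[OF \<Omega>.finite_measure_axioms s\<Omega> V \<Omega>0])
    define A where "A = (\<Union>K\<in>\<K>. V ` K)"
    have A: "A \<in> sets borel"
      unfolding A_def using \<K>(1-3)
      by (intro sets.countable_UN') (auto intro!: borel_compact compact_continuous_image)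
    have "AE p in \<Omega>. V p \<in> A"
      using \<K>(5) AE_\<Omega>0 by eventually_elim (auto simp: A_def)
    then have "emeasure \<pi> A = 1"
      by (rule full[OF A])
    \<comment> \<open>Distinct first points on one leaf have different gauge values, so
      \<open>Q0 p < Q0 p'\<close>. Strictness forces \<open>snd p \<le> snd p'\<close>, because
      \<open>Q0\<close> is monotone in the level; then \<open>Q1\<close> preserves this
      order.\<close>
    have mono: "le (snd (V p)) (snd (V p'))"
      if p: "p \<in> \<Omega>0" "p' \<in> \<Omega>0" and "le (fst (V p)) (fst (V p'))" "fst (V p) \<noteq> fst (V p')" for p p'
    proof -
      have eq: "fst p = fst p'" and "Q0 p \<le> Q0 p'"
        using that V_S[OF p(1)] V_S[OF p(2)] by (auto simp: V_def le_iff)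
      moreover have "Q0 p \<noteq> Q0 p'"
        using that(4) eq by (auto simp: V_def)
      ultimately have "\<not> Q0 p' \<le> Q0 p" by simp
      then have "snd p \<le> snd p'"
        using cond_quantile_mono[of "snd p'" "snd p" \<nu>0 "fst p"] eq unfolding Q0_def by force
      then have "Q1 p \<le> Q1 p'"
        unfolding Q1_def eq by (rule cond_quantile_mono)
      then show ?thesis
        using V_S[OF p(1)] V_S[OF p(2)] eq by (simp add: V_def le_iff)
    qed
    have img: "\<exists>p\<in>\<Omega>0. V p = q" if q: "q \<in> A" for q
    proof -
      obtain K p where "K \<in> \<K>" "p \<in> K" "q = V p"
        using q unfolding A_def by blast
      then show ?thesis using \<K>(4) by blast
    qed
    have "monotone_set le A"
      unfolding monotone_set_def
    proof clarify
      fix x1 y1 x2 y2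
      assume "(x1, y1) \<in> A" "(x2, y2) \<in> A" and le: "le x1 x2" "x1 \<noteq> x2"
      then obtain p p' where p: "p \<in> \<Omega>0" "p' \<in> \<Omega>0" "V p = (x1, y1)" "V p' = (x2, y2)"
        using img[of "(x1, y1)"] img[of "(x2, y2)"] by blast
      show "le y1 y2"
        using mono[OF p(1,2)] le unfolding p(3,4) by simp
    qed
    with \<open>emeasure \<pi> A = 1\<close> show ?thesis
      using A unfolding concentrated_on_monotone_def by blast
  qed
  ultimately show ?thesis by blast
qed

end

section \<open>From the gauged null set to the leafwise order\<close>

theorem proposition6p4:
  fixes ll le :: "'a::polish_space \<Rightarrow> 'a \<Rightarrow> bool"
    and H :: "'a set" and G :: "'a \<Rightarrow> real" and \<mu>0 \<mu>1 :: "'a measure"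
  assumes "topological_causal_space ll le"
    and "closed H" and "achronal ll H"
    and "null_nonbranching le H" and "weakly_convex le H"
    and "gauge_for le H G"
    and "borel_prob_on (inner_part le H) \<mu>0" and "borel_prob_on (inner_part le H) \<mu>1"
    and "causal_couplings le \<mu>0 \<mu>1 \<noteq> {}"
  shows "\<exists>!\<pi>. \<pi> \<in> causal_couplings le \<mu>0 \<mu>1 \<and> concentrated_on_monotone le \<pi>"
proof -
  interpret topological_causal_space ll le by fact
  interpret gauged_null_set ll le H G
    by unfold_locales (fact assms)+
  obtain \<Phi> :: "'a \<Rightarrow> nat \<Rightarrow> real" where \<Phi>: "\<Phi> \<in> borel_measurable borel"
    "\<forall>x\<in>core. \<forall>y\<in>core. \<Phi> x = \<Phi> y \<longleftrightarrow> comparable x y"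
    by (rule exists_leaf_map)
  \<comment> \<open>The arctangent compresses the gauge into the unit interval and keeps it strictly
    increasing on leaves; the indicator extends it by \<open>0\<close> to a Borel function on the
    whole space.\<close>
  define g where "g x = 1 / 2 + arctan (indicator core x *\<^sub>R G x) / pi" for x
  have g_less: "g x < g y" if "x \<in> core" "y \<in> core" "le x y" "x \<noteq> y" for x y
    using gauge_strict_mono[OF that] that by (simp add: g_def arctan_less_iff divide_strict_right_mono)
  interpret leafwise_order le core \<Phi> g
  proof
    have "(\<lambda>x. indicator core x *\<^sub>R G x) \<in> borel_measurable borel"
      using gauge core_borel
      by (subst borel_measurable_restrict_space_iff[symmetric]) (auto simp: gauge_for_def)
    then show "g \<in> borel_measurable borel"
      unfolding g_def by measurable
    show "g x \<in> {0..1}" for x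
      using arctan_lbound[of "indicator core x *\<^sub>R G x"] arctan_ubound[of "indicator core x *\<^sub>R G x"]
      by (auto simp: g_def field_simps)
    show "causal_rel le \<in> sets borel"
      using closed_le by (rule borel_closed)
    \<comment> \<open>Equal leaves make the points comparable, and strict monotonicity of
      \<open>g\<close> then decides the direction.\<close>
    show "le x y \<longleftrightarrow> \<Phi> x = \<Phi> y \<and> g x \<le> g y" if xy: "x \<in> core" "y \<in> core" for x y
      using g_less[OF xy] g_less[OF xy(2,1)] \<Phi>(2) xy le_refl[of x]
      unfolding comparable_def by fastforce
    show "x = y" if xy: "x \<in> core" "y \<in> core" "\<Phi> x = \<Phi> y" "g x = g y" for x y
      using g_less[OF xy(1,2)] g_less[OF xy(2,1)] \<Phi>(2) xy unfolding comparable_def by fastforce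
  qed (fact core_borel \<Phi>(1))+
  show ?thesis
    using monotone_coupling_exists[OF assms(7-9)] monotone_coupling_unique[OF assms(7,8)] by blast
qed

end
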